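(* Let $d$ and $s$ be positive integers. If, for some positive integer $n_0$, one has $s(dn_0+1)\leq\binom{n_0+d}{d}$ and $\sigma_s(\mathrm{Split}_d(\mathbb{P}^{n_0}))$ is nondefective, then $\sigma_s(\mathrm{Split}_d(\mathbb{P}^n))$ is nondefective for all integers $n\geq n_0$.
   Context: Let $\Bbbk$ be an algebraically closed field of characteristic zero, $R=\Bbbk[x_0,\ldots,x_n]$ with the usual grading, $R_d$ the $\Bbbk$-vector space of forms of degree $d$ in $R$, and $N=\binom{n+d}{d}-1$, so that $\mathbb{P}R_d=\mathbb{P}^N$. The Chow variety is $\mathrm{Split}_d(\mathbb{P}^n)=\{[\ell_1\cdots\ell_d]\in\mathbb{P}^N : \ell_1,\ldots,\ell_d\in R_1\}$ (with the $\ell_i$ nonzero). For a variety $X\subset\mathbb{P}^N$, the $s$th secant variety $\sigma_s(X)$ is the Zariski closure of $\bigcup_{x_1,\ldots,x_s\in X}\langle x_1,\ldots,x_s\rangle$, where $\langle\cdot\rangle$ denotes projective linear span. The expected dimension is $\mathrm{expdim}\,\sigma_s(\mathrm{Split}_d(\mathbb{P}^n))=\min\left\{s(dn+1),\binom{n+d}{d}\right\}-1$. The variety $\sigma_s(\mathrm{Split}_d(\mathbb{P}^n))$ is nondefective if its dimension equals this expected dimension, and defective otherwise. *)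

theory Defs
  imports
    "HOL-Analysis.Analysis"
    "HOL-Computational_Algebra.Computational_Algebra"
    "HOL-Library.Poly_Mapping"
begin
text \<open>Exponent vectors are finitely supported maps \<open>'v \<Rightarrow>\<^sub>0 nat\<close>, and polynomials in the
  variables \<open>'v\<close> are elements of the monoid algebra \<open>('v \<Rightarrow>\<^sub>0 nat) \<Rightarrow>\<^sub>0 'k\<close>.\<close>

type_synonym ('v, 'k) mpoly = "('v \<Rightarrow>\<^sub>0 nat) \<Rightarrow>\<^sub>0 'k"

definition mdeg :: "('v \<Rightarrow>\<^sub>0 nat) \<Rightarrow> nat" where
  "mdeg m = (\<Sum>v\<in>Poly_Mapping.keys m. Poly_Mapping.lookup m v)"

definition monoms :: "'v set \<Rightarrow> nat \<Rightarrow> ('v \<Rightarrow>\<^sub>0 nat) set" where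
  "monoms V d = {m. Poly_Mapping.keys m \<subseteq> V \<and> mdeg m = d}"

text \<open>The ring \<open>\<Bbbk>[x\<^sub>0, \<dots>, x\<^sub>n]\<close> has variables indexed by \<open>{..n}\<close>, so that \<open>R\<^sub>d\<close> is
  \<open>forms {..n} d\<close>.  As usual, the zero polynomial is a form of every degree.\<close>

definition forms :: "'v set \<Rightarrow> nat \<Rightarrow> ('v, 'k::zero) mpoly set" where
  "forms V d = {F. Poly_Mapping.keys F \<subseteq> monoms V d}"

definition mono_eval :: "('v \<Rightarrow>\<^sub>0 nat) \<Rightarrow> ('v \<Rightarrow> 'k) \<Rightarrow> 'k::comm_semiring_1" where
  "mono_eval m a = (\<Prod>v\<in>Poly_Mapping.keys m. a v ^ Poly_Mapping.lookup m v)"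

definition mp_eval :: "('v, 'k) mpoly \<Rightarrow> ('v \<Rightarrow> 'k) \<Rightarrow> 'k::comm_semiring_1" where
  "mp_eval F a = (\<Sum>m\<in>Poly_Mapping.keys F. Poly_Mapping.lookup F m * mono_eval m a)"

text \<open>A finitely supported map \<open>'v \<Rightarrow>\<^sub>0 'k\<close> is a vector with coordinates indexed by \<open>'v\<close>.\<close>

definition pm_scale :: "'k \<Rightarrow> ('v \<Rightarrow>\<^sub>0 'k) \<Rightarrow> ('v \<Rightarrow>\<^sub>0 'k::field)" where
  "pm_scale c f = Poly_Mapping.map ((*) c) f"

lemma lookup_pm_scale [simp]:
  "Poly_Mapping.lookup (pm_scale c f) v = c * Poly_Mapping.lookup f v"
  by (simp add: pm_scale_def map.rep_eq when_def)

interpretation pm: vector_space pm_scale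
  by standard (simp_all add: poly_mapping_eq_iff fun_eq_iff lookup_add algebra_simps)

text \<open>The projective space of the vector space with coordinates indexed by \<open>V\<close>; its points are the
  one-dimensional subspaces.  In particular \<open>\<P>R\<^sub>d\<close> is \<open>proj_space (monoms {..n} d)\<close>: a form of
  degree \<open>d\<close> is the vector of its coefficients, indexed by the monomials of degree \<open>d\<close>.\<close>

definition proj_space :: "'v set \<Rightarrow> ('v \<Rightarrow>\<^sub>0 'k::field) set set" where
  "proj_space V = {pm.span {f} | f. Poly_Mapping.keys f \<subseteq> V \<and> f \<noteq> 0}"

definition proj_span :: "'v set \<Rightarrow> ('v \<Rightarrow>\<^sub>0 'k::field) set set \<Rightarrow> ('v \<Rightarrow>\<^sub>0 'k) set set" where
  "proj_span V X = {P \<in> proj_space V. P \<subseteq> pm.span (\<Union>X)}"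

definition proj_zeros ::
    "'v set \<Rightarrow> ('v, 'k) mpoly set \<Rightarrow> ('v \<Rightarrow>\<^sub>0 'k::field) set set" where
  "proj_zeros V T =
     {P \<in> proj_space V. \<forall>F\<in>T. \<forall>f\<in>P. mp_eval F (Poly_Mapping.lookup f) = 0}"

definition zariski :: "'v set \<Rightarrow> ('v \<Rightarrow>\<^sub>0 'k::field) set topology" where
  "zariski V = topology (\<lambda>U. \<exists>T \<subseteq> (\<Union>e. forms V e). U = proj_space V - proj_zeros V T)"

definition irreducible_closed :: "'a topology \<Rightarrow> 'a set \<Rightarrow> bool" where
  "irreducible_closed X Z \<longleftrightarrow> closedin X Z \<and> Z \<noteq> {} \<and>
     (\<forall>A B. closedin X A \<and> closedin X B \<and> Z \<subseteq> A \<union> B \<longrightarrow> Z \<subseteq> A \<or> Z \<subseteq> B)"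

text \<open>The Krull dimension of a topological space: the supremum of the lengths \<open>m\<close> of chains
  \<open>Z\<^sub>0 \<subset> Z\<^sub>1 \<subset> \<dots> \<subset> Z\<^sub>m\<close> of irreducible closed subsets.  The empty space gets dimension \<open>0\<close> here;
  the secant varieties considered below are nonempty for \<open>s, d > 0\<close>.\<close>

definition krull_dim :: "'a topology \<Rightarrow> enat" where
  "krull_dim X = Sup {enat m | m. \<exists>Z :: nat \<Rightarrow> 'a set.
     (\<forall>i\<le>m. irreducible_closed X (Z i)) \<and> (\<forall>i<m. Z i \<subset> Z (Suc i))}"

text \<open>The points \<open>x\<^sub>1, \<dots>, x\<^sub>s\<close> need not be distinct.\<close>

definition secant :: "'v set \<Rightarrow> nat \<Rightarrow> ('v \<Rightarrow>\<^sub>0 'k::field) set set \<Rightarrow> ('v \<Rightarrow>\<^sub>0 'k) set set" where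
  "secant V s X =
     zariski V closure_of (\<Union>x \<in> {x :: nat \<Rightarrow> _. \<forall>i<s. x i \<in> X}. proj_span V (x ` {..<s}))"

definition Split :: "nat \<Rightarrow> nat \<Rightarrow> (nat, 'k::field) mpoly set set" where
  "Split d n =
     {pm.span {\<Prod>i<d. l i} | l :: nat \<Rightarrow> (nat, 'k) mpoly. \<forall>i<d. l i \<in> forms {..n} 1 - {0}}"

text \<open>For \<open>s > 0\<close> the minimum is positive, so the subtraction does not truncate.\<close>

definition expdim :: "nat \<Rightarrow> nat \<Rightarrow> nat \<Rightarrow> nat" where
  "expdim s d n = min (s * (d * n + 1)) ((n + d) choose d) - 1"

text \<open>The type argument is the ground field.\<close>

definition nondefective :: "'k::field itself \<Rightarrow> nat \<Rightarrow> nat \<Rightarrow> nat \<Rightarrow> bool" where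
  "nondefective TYPE('k) s d n \<longleftrightarrow>
     krull_dim (subtopology (zariski (monoms {..n} d))
       (secant (monoms {..n} d) s (Split d n :: (nat, 'k) mpoly set set))) = enat (expdim s d n)"

lemma mono_eval_superset:
  assumes "finite S" "Poly_Mapping.keys m \<subseteq> S"
  shows "mono_eval m a = (\<Prod>v\<in>S. a v ^ Poly_Mapping.lookup m v)"
  unfolding mono_eval_def
  by (rule prod.mono_neutral_left) (use assms in \<open>auto simp: in_keys_iff\<close>)

lemma mono_eval_add: "mono_eval (m + m') a = mono_eval m a * mono_eval m' a"
proof -
  let ?S = "Poly_Mapping.keys m \<union> Poly_Mapping.keys m'"
  have "Poly_Mapping.keys (m + m') \<subseteq> ?S"
    by (rule Poly_Mapping.keys_add)
  then show ?thesis
    by (simp add: mono_eval_superset[of ?S] lookup_add power_add prod.distrib)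
qed

lemma mono_eval_scale: "mono_eval m (\<lambda>v. c * a v) = c ^ mdeg m * mono_eval m a"
  by (simp add: mono_eval_def mdeg_def power_mult_distrib prod.distrib power_sum)

lemma mp_eval_superset:
  assumes "finite S" "Poly_Mapping.keys F \<subseteq> S"
  shows "mp_eval F a = (\<Sum>m\<in>S. Poly_Mapping.lookup F m * mono_eval m a)"
  unfolding mp_eval_def
  by (rule sum.mono_neutral_left) (use assms in \<open>auto simp: in_keys_iff\<close>)

lemma mp_eval_0 [simp]: "mp_eval 0 a = 0"
  by (simp add: mp_eval_def)

lemma mp_eval_add: "mp_eval (F + G) a = mp_eval F a + mp_eval G a"
proof -
  let ?S = "Poly_Mapping.keys F \<union> Poly_Mapping.keys G"
  have "Poly_Mapping.keys (F + G) \<subseteq> ?S"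
    by (rule Poly_Mapping.keys_add)
  then show ?thesis
    by (simp add: mp_eval_superset[of ?S] lookup_add algebra_simps sum.distrib)
qed

lemma mp_eval_sum: "mp_eval (\<Sum>i\<in>I. F i) a = (\<Sum>i\<in>I. mp_eval (F i) a)"
  by (induction I rule: infinite_finite_induct) (simp_all add: mp_eval_add)

lemma mp_eval_single: "mp_eval (Poly_Mapping.single m c) a = c * mono_eval m a"
  by (simp add: mp_eval_def)

lemma poly_mapping_sum_single:
  "(F :: 'a \<Rightarrow>\<^sub>0 'b::comm_monoid_add) =
     (\<Sum>m\<in>Poly_Mapping.keys F. Poly_Mapping.single m (Poly_Mapping.lookup F m))"
  by (rule poly_mapping_eqI)
    (auto simp: lookup_sum lookup_single when_def in_keys_iff)

lemma mp_eval_mult: "mp_eval (F * G) a = mp_eval F a * mp_eval G a"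
proof -
  have "mp_eval (F * G) a =
      mp_eval ((\<Sum>m\<in>Poly_Mapping.keys F. Poly_Mapping.single m (Poly_Mapping.lookup F m)) *
        (\<Sum>m\<in>Poly_Mapping.keys G. Poly_Mapping.single m (Poly_Mapping.lookup G m))) a"
    using poly_mapping_sum_single[of F] poly_mapping_sum_single[of G] by simp
  also have "\<dots> = mp_eval F a * mp_eval G a"
    by (simp add: sum_product mult_single mp_eval_sum mp_eval_single mono_eval_add
        mp_eval_def[of F] mp_eval_def[of G] mult_ac)
  finally show ?thesis .
qed

lemma mp_eval_scale:
  assumes "F \<in> forms V e"
  shows "mp_eval F (\<lambda>v. c * a v) = c ^ e * mp_eval F a"
proof -
  have "mdeg m = e" if "m \<in> Poly_Mapping.keys F" for m
    using assms that by (auto simp: forms_def monoms_def)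
  then show ?thesis
    by (simp add: mp_eval_def mono_eval_scale sum_distrib_left mult_ac)
qed

lemma mdeg_add: "mdeg (m + m') = mdeg m + mdeg m'"
proof -
  let ?S = "Poly_Mapping.keys m \<union> Poly_Mapping.keys m'"
  have *: "mdeg p = (\<Sum>v\<in>?S. Poly_Mapping.lookup p v)" if "Poly_Mapping.keys p \<subseteq> ?S" for p
    unfolding mdeg_def
    by (rule sum.mono_neutral_left) (use that in \<open>auto simp: in_keys_iff\<close>)
  show ?thesis
    using *[OF Poly_Mapping.keys_add] *[of m] *[of m'] by (simp add: lookup_add sum.distrib)
qed

lemma forms_mult:
  fixes F :: "('v, 'k::semiring_0) mpoly"
  assumes "F \<in> forms V d" "G \<in> forms V e"
  shows "F * G \<in> forms V (d + e)"
  unfolding forms_def mem_Collect_eq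
proof
  fix m assume "m \<in> Poly_Mapping.keys (F * G)"
  then obtain a b where ab: "a \<in> Poly_Mapping.keys F" "b \<in> Poly_Mapping.keys G" "m = a + b"
    using keys_mult[of F G] by blast
  then have "a \<in> monoms V d" "b \<in> monoms V e"
    using assms by (auto simp: forms_def)
  then show "m \<in> monoms V (d + e)"
    using Poly_Mapping.keys_add[of a b] unfolding monoms_def ab(3) by (auto simp: mdeg_add)
qed

lemma forms_prod: "(\<And>i. i < d \<Longrightarrow> l i \<in> forms V 1) \<Longrightarrow> (\<Prod>i<d. l i) \<in> forms V d"
  for l :: "nat \<Rightarrow> ('v, 'k::comm_semiring_1) mpoly"
proof (induction d)
  case 0
  show ?case
    by (auto simp: forms_def monoms_def mdeg_def)
next
  case (Suc d)
  have "(\<Prod>i<d. l i) * l d \<in> forms V (d + 1)"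
    by (rule forms_mult) (use Suc in auto)
  then show ?case
    by (simp add: mult.commute)
qed

lemma proj_space_cases:
  assumes "P \<in> proj_space V"
  obtains f where "f \<noteq> 0" "Poly_Mapping.keys f \<subseteq> V" "P = range (\<lambda>c. pm_scale c f)"
  using assms by (auto simp: proj_space_def pm.span_singleton)

lemma mp_eval_point:
  assumes "F \<in> forms V e" "P = range (\<lambda>c. pm_scale c f)"
  shows "(\<forall>g\<in>P. mp_eval F (Poly_Mapping.lookup g) = 0) \<longleftrightarrow>
         mp_eval F (Poly_Mapping.lookup f) = 0"
proof -
  have *: "mp_eval F (Poly_Mapping.lookup (pm_scale c f)) =
      c ^ e * mp_eval F (Poly_Mapping.lookup f)" for c
    using mp_eval_scale[OF assms(1), of c "Poly_Mapping.lookup f"]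
    by (simp add: lookup_pm_scale[abs_def])
  have "f \<in> P"
    using assms(2) pm.scale_one by (metis rangeI)
  then show ?thesis
    using assms(2) * by auto
qed

lemma proj_zeros_Int:
  fixes T1 T2 :: "('v, 'k::field) mpoly set"
  assumes "T1 \<subseteq> (\<Union>e. forms V e)" "T2 \<subseteq> (\<Union>e. forms V e)"
  shows "proj_zeros V T1 \<union> proj_zeros V T2 =
         proj_zeros V ((\<lambda>(F, G). F * G) ` (T1 \<times> T2))"
proof (intro equalityI subsetI)
  fix P assume "P \<in> proj_zeros V T1 \<union> proj_zeros V T2"
  then show "P \<in> proj_zeros V ((\<lambda>(F, G). F * G) ` (T1 \<times> T2))"
    by (auto simp: proj_zeros_def mp_eval_mult)
next
  fix P assume P: "P \<in> proj_zeros V ((\<lambda>(F, G). F * G) ` (T1 \<times> T2))"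
  then have PV: "P \<in> proj_space V"
    by (simp add: proj_zeros_def)
  then obtain f where f: "P = range (\<lambda>c. pm_scale c f)"
    by (rule proj_space_cases)
  have fP: "f \<in> P"
    using f pm.scale_one by (metis rangeI)
  show "P \<in> proj_zeros V T1 \<union> proj_zeros V T2"
  proof (rule ccontr)
    assume "P \<notin> proj_zeros V T1 \<union> proj_zeros V T2"
    then obtain F G where FG: "F \<in> T1" "G \<in> T2"
      "\<not> (\<forall>g\<in>P. mp_eval F (Poly_Mapping.lookup g) = 0)"
      "\<not> (\<forall>g\<in>P. mp_eval G (Poly_Mapping.lookup g) = 0)"
      using PV by (auto simp: proj_zeros_def)
    obtain d e where "F \<in> forms V d" "G \<in> forms V e"
      using FG assms by blast
    then have "mp_eval F (Poly_Mapping.lookup f) \<noteq> 0" "mp_eval G (Poly_Mapping.lookup f) \<noteq> 0"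
      using FG f mp_eval_point by blast+
    then have "mp_eval (F * G) (Poly_Mapping.lookup f) \<noteq> 0"
      by (simp add: mp_eval_mult)
    moreover have "mp_eval (F * G) (Poly_Mapping.lookup f) = 0"
      using P FG(1,2) fP by (auto simp: proj_zeros_def)
    ultimately show False
      by simp
  qed
qed

lemma istopology_zariski:
  "istopology (\<lambda>U. \<exists>T \<subseteq> (\<Union>e. forms V e). U = proj_space V - proj_zeros V T)"
  (is "istopology ?open")
  unfolding istopology_def
proof (intro conjI allI impI)
  fix A B assume "?open A" "?open B"
  then obtain T1 T2 where T:
    "T1 \<subseteq> (\<Union>e. forms V e)" "A = proj_space V - proj_zeros V T1"
    "T2 \<subseteq> (\<Union>e. forms V e)" "B = proj_space V - proj_zeros V T2"
    by blast
  have "(\<lambda>(F, G). F * G) ` (T1 \<times> T2) \<subseteq> (\<Union>e. forms V e)"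
  proof
    fix H assume "H \<in> (\<lambda>(F, G). F * G) ` (T1 \<times> T2)"
    then obtain F G where FG: "F \<in> T1" "G \<in> T2" "H = F * G"
      by auto
    then obtain d e where "F \<in> forms V d" "G \<in> forms V e"
      using T(1,3) by blast
    then show "H \<in> (\<Union>e. forms V e)"
      using forms_mult FG(3) by blast
  qed
  moreover have "A \<inter> B = proj_space V - proj_zeros V ((\<lambda>(F, G). F * G) ` (T1 \<times> T2))"
    using proj_zeros_Int[OF T(1,3)] T(2,4) by blast
  ultimately show "?open (A \<inter> B)"
    by blast
next
  fix K assume "\<forall>U\<in>K. ?open U"
  then obtain T where T: "\<And>U. U \<in> K \<Longrightarrow> T U \<subseteq> (\<Union>e. forms V e)"
    "\<And>U. U \<in> K \<Longrightarrow> U = proj_space V - proj_zeros V (T U)"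
    by metis
  have "\<Union>K = proj_space V - proj_zeros V (\<Union>U\<in>K. T U)"
  proof (intro equalityI subsetI)
    fix P assume "P \<in> \<Union>K"
    then obtain U where U: "U \<in> K" "P \<in> U"
      by blast
    then have "P \<in> proj_space V - proj_zeros V (T U)"
      using T(2) by blast
    then show "P \<in> proj_space V - proj_zeros V (\<Union>U\<in>K. T U)"
      using U(1) by (auto simp: proj_zeros_def)
  next
    fix P assume "P \<in> proj_space V - proj_zeros V (\<Union>U\<in>K. T U)"
    then obtain U where U: "U \<in> K" "P \<in> proj_space V - proj_zeros V (T U)"
      by (auto simp: proj_zeros_def)
    then show "P \<in> \<Union>K"
      using T(2) by blast
  qed
  moreover have "(\<Union>U\<in>K. T U) \<subseteq> (\<Union>e. forms V e)"
    using T(1) by blast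
  ultimately show "?open (\<Union>K)"
    by blast
qed

lemma openin_zariski:
  "openin (zariski V) U \<longleftrightarrow>
     (\<exists>T \<subseteq> (\<Union>e. forms V e). U = proj_space V - proj_zeros V T)"
  unfolding zariski_def by (simp add: topology_inverse'[OF istopology_zariski])

lemma proj_zeros_one: "proj_zeros V {1 :: ('v, 'k::field) mpoly} = {}"
proof -
  have "mp_eval (1 :: ('v, 'k) mpoly) a = 1" for a
    by (simp add: mp_eval_def mono_eval_def)
  then show ?thesis
    by (auto simp: proj_zeros_def proj_space_def intro: pm.span_zero)
qed

lemma topspace_zariski: "topspace (zariski V :: ('v \<Rightarrow>\<^sub>0 'k::field) set topology) = proj_space V"
proof -
  have "(1 :: ('v, 'k) mpoly) \<in> forms V 0"
    by (auto simp: forms_def monoms_def mdeg_def)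
  then have "openin (zariski V) (proj_space V :: ('v \<Rightarrow>\<^sub>0 'k) set set)"
    unfolding openin_zariski using proj_zeros_one[where ?'k = 'k, of V]
    by (intro exI[of _ "{1}"]) auto
  moreover have "U \<subseteq> proj_space V" if "openin (zariski V) U" for U :: "('v \<Rightarrow>\<^sub>0 'k) set set"
    using that by (auto simp: openin_zariski)
  ultimately show ?thesis
    by (meson openin_subset openin_topspace subset_antisym)
qed

lemma closedin_zariski:
  "closedin (zariski V) Z \<longleftrightarrow> (\<exists>T \<subseteq> (\<Union>e. forms V e). Z = proj_zeros V T)"
proof -
  have "proj_zeros V T \<subseteq> proj_space V" for T :: "('a, 'b) mpoly set"
    by (auto simp: proj_zeros_def)
  then show ?thesis
    unfolding closedin_def topspace_zariski openin_zariski
    by (metis Diff_subset double_diff order_refl)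
qed

lemma Split_subset_proj_space: "(Split d n :: (nat, 'k::field) mpoly set set) \<subseteq> proj_space (monoms {..n} d)"
proof
  fix P :: "(nat, 'k) mpoly set" assume "P \<in> Split d n"
  then obtain l where l: "P = pm.span {\<Prod>i<d. l i}" "\<And>i. i < d \<Longrightarrow> l i \<in> forms {..n} 1 - {0}"
    by (auto simp: Split_def)
  have "(\<Prod>i<d. l i) \<in> forms {..n} d"
    by (rule forms_prod) (use l in auto)
  moreover have "(\<Prod>i<d. l i) \<noteq> 0"
    using l(2) by auto
  ultimately show "P \<in> proj_space (monoms {..n} d)"
    unfolding proj_space_def forms_def using l(1) by blast
qed

end

theory Submission
  imports Defs
begin

text \<open>After normalizing leading coefficients, the cone over the secant variety is parametrized, up to one
  overall scalar, by \<open>q = s (d n + 1) - 1\<close> coefficients of the linear factors of a sum of \<open>s\<close> products.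
  Dimensions are compared through the growth of Hilbert functions: a chain of \<open>m + 1\<close> irreducible
  closed subsets forces growth of order at least \<open>e ^ m\<close>, while a parametrization by \<open>q\<close> coefficients
  allows at most order \<open>e ^ q\<close>.  Dimension \<open>q\<close> for \<open>n\<^sub>0\<close> therefore excludes a polynomial vector field
  along which the parametrization moves only by scalars, so at some point the sum of products and its
  \<open>q\<close> partial derivatives are linearly independent.  At the same point this independence persists
  for \<open>n \<ge> n\<^sub>0\<close>: the derivatives in the new directions are \<open>x\<^sub>k\<close> times products of \<open>d - 1\<close> of the old
  linear factors, and these products are independent since their multiples by \<open>x\<^sub>1\<close> are among the
  old derivatives.  Conversely, independence at a point yields a chain of closures of images of
  coordinate subspaces that is strictly increasing, as leading terms at the point show.\<close>

text \<open>Chains of closed sets say nothing directly about tangent vectors; counting forms links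
  the two, since both a chain and a set of independent derivatives produce many independent forms.
  The sum itself is tested together with its derivatives because the \<open>q\<close> parameters
  leave out the overall scalar, so motion along the line through the point does not count. A
  relation among these vectors for generic coefficients reads
  \<open>D \<phi>_v = - c_0 * \<phi>_v\<close> for all coordinates \<open>\<phi>_v\<close>, with
  \<open>D\<close> a combination of partial derivatives. Such a \<open>D\<close> is excluded without
  transcendence degrees: all pulled back forms of degree \<open>e\<close> have the same eigenvalue,
  so in characteristic zero the powers of a variable \<open>X\<close> with
  \<open>D X \<noteq> 0\<close> are independent over them, and a chain of length \<open>m\<close>
  would force growth of order \<open>m + 1\<close> in \<open>q\<close> variables. The count
  \<open>q\<close> must be exact, as it bounds the dimension from above for every \<open>n\<close>;
  under the inequality on \<open>n_0\<close> it is the expected dimension. Normalization achieves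
  this, and the sums that it misses, those with a zero leading coefficient, impose no further
  condition on a form.\<close>

abbreviation "lookup \<equiv> Poly_Mapping.lookup"
abbreviation "keys \<equiv> Poly_Mapping.keys"

section \<open>Polynomials: evaluation, substitution, partial derivatives\<close>

lemma poly_mapping_add_induct [case_names zero single add]:
  fixes F :: "'a \<Rightarrow>\<^sub>0 'b::comm_monoid_add"
  assumes "P 0" and "\<And>m c. P (Poly_Mapping.single m c)"
    and "\<And>F G. P F \<Longrightarrow> P G \<Longrightarrow> P (F + G)"
  shows "P F"
proof -
  have "P (\<Sum>m\<in>S. Poly_Mapping.single m (lookup F m))" if "finite S" for S
    using that by induction (use assms in auto)
  from this[of "keys F"] show ?thesis
    using poly_mapping_sum_single[of F] by simp
qed

lemma mono_eval_nonzero_distinct: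
  assumes "m \<noteq> m'"
  obtains a :: "'v \<Rightarrow> 'k::field_char_0" where "mono_eval m a \<noteq> mono_eval m' a"
proof -
  obtain v where v: "lookup m v \<noteq> lookup m' v"
    using assms by (metis poly_mapping_eqI)
  \<comment> \<open>With a single coordinate equal to 2, monomials become powers of 2, which are
    distinct in characteristic zero.\<close>
  define a :: "'v \<Rightarrow> 'k" where "a = (\<lambda>_. 1)(v := 2)"
  have "mono_eval p a = 2 ^ lookup p v" for p
  proof -
    have "mono_eval p a = (\<Prod>u\<in>insert v (keys p). a u ^ lookup p u)"
      by (rule mono_eval_superset) auto
    also have "\<dots> = (\<Prod>u\<in>{v}. a u ^ lookup p u)"
      by (rule prod.mono_neutral_right) (auto simp: a_def)
    finally show ?thesis by (simp add: a_def)
  qed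
  moreover have "(2 :: 'k) ^ i \<noteq> 2 ^ j" if "i \<noteq> j" for i j
  proof
    assume "(2 :: 'k) ^ i = 2 ^ j"
    then have "of_nat (2 ^ i) = (of_nat (2 ^ j) :: 'k)"
      by simp
    then show False using that by (simp only: of_nat_eq_iff) simp
  qed
  ultimately show ?thesis using v that by metis
qed

lemma mono_eval_times: "mono_eval m (\<lambda>v. a v * b v) = mono_eval m a * mono_eval m b"
  by (simp add: mono_eval_def power_mult_distrib prod.distrib)

text \<open>Dedekind's independence of characters: monomials are multiplicative functions of the point.\<close>

lemma mono_eval_independent:
  fixes c :: "('v \<Rightarrow>\<^sub>0 nat) \<Rightarrow> 'k::field_char_0"
  assumes "finite S" and "\<And>a. (\<Sum>m\<in>S. c m * mono_eval m a) = 0" and "m \<in> S"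
  shows "c m = 0"
  using assms
proof (induction S arbitrary: c m rule: finite_induct)
  case (insert m0 S)
  have S0: "c m = 0" if m: "m \<in> S" for m
  proof -
    have "m \<noteq> m0" using m insert by auto
    then obtain b :: "'v \<Rightarrow> 'k" where b: "mono_eval m b \<noteq> mono_eval m0 b"
      by (rule mono_eval_nonzero_distinct)
    \<comment> \<open>Evaluating the relation at the product of \<open>b\<close> and
      \<open>a\<close> and subtracting \<open>mono_eval m0 b\<close> times the original relation
      cancels the term of \<open>m0\<close>.\<close>
    have "(\<Sum>m\<in>S. (c m * (mono_eval m b - mono_eval m0 b)) * mono_eval m a) = 0" for a
    proof -
      have "(\<Sum>m\<in>insert m0 S. c m * mono_eval m (\<lambda>v. b v * a v))
          - mono_eval m0 b * (\<Sum>m\<in>insert m0 S. c m * mono_eval m a) = 0"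
        using insert.prems(1) by simp
      then show ?thesis
        using insert.hyps by (simp add: mono_eval_times sum_distrib_left sum_subtractf algebra_simps)
    qed
    then have "c m * (mono_eval m b - mono_eval m0 b) = 0"
      using insert.IH[of "\<lambda>m. c m * (mono_eval m b - mono_eval m0 b)"] m by blast
    then show ?thesis using b by simp
  qed
  have "c m0 * mono_eval m0 (\<lambda>_. 1) = 0"
    using insert.prems(1)[of "\<lambda>_. 1"] insert.hyps S0 by simp
  then have "c m0 = 0" by (simp add: mono_eval_def)
  then show ?case using S0 insert.prems by auto
qed simp

lemma mp_eval_eq_0_imp_0:
  fixes F :: "('v, 'k::field_char_0) mpoly"
  assumes "\<And>a. mp_eval F a = 0"
  shows "F = 0"
proof (rule poly_mapping_eqI)
  fix m
  show "lookup F m = lookup 0 m"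
    using mono_eval_independent[of "keys F" "lookup F" m] assms
    by (cases "m \<in> keys F") (auto simp: mp_eval_def in_keys_iff)
qed

lemma mp_eval_scalar: "mp_eval (pm_scale c F) a = c * mp_eval F a"
proof -
  have "mp_eval (pm_scale c F) a = (\<Sum>m\<in>keys F. lookup (pm_scale c F) m * mono_eval m a)"
    by (rule mp_eval_superset) (auto simp: in_keys_iff)
  then show ?thesis by (simp add: mp_eval_def sum_distrib_left mult.assoc)
qed

lemma mp_eval_1 [simp]: "mp_eval 1 a = 1"
  by (simp add: mp_eval_def mono_eval_def)

lemma mp_eval_prod: "mp_eval (\<Prod>i\<in>I. F i) a = (\<Prod>i\<in>I. mp_eval (F i) a)"
  by (induction I rule: infinite_finite_induct) (simp_all add: mp_eval_mult)

lemma mp_eval_power: "mp_eval (F ^ n) a = mp_eval F a ^ n"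
  by (induction n) (simp_all add: mp_eval_mult)

lemma mp_eval_diff: "mp_eval (F - G) a = mp_eval F a - (mp_eval G a :: 'k::field)"
  using mp_eval_add[of "F - G" G a] by simp

lemma pm_scale_eq_single_mult: "pm_scale c F = Poly_Mapping.single 0 c * F"
  for F :: "('v, 'k::field) mpoly"
proof (induction F rule: poly_mapping_add_induct)
  case (add F G)
  then show ?case by (simp add: pm.scale_right_distrib distrib_left)
next
  case (single m b)
  show ?case
    by (rule poly_mapping_eqI) (simp add: mult_single lookup_single when_def)
qed simp

lemma pm_scale_mult_left: "pm_scale c F * G = pm_scale c (F * G)"
  for F G :: "('v, 'k::field) mpoly"
  by (simp add: pm_scale_eq_single_mult mult.assoc)

lemma pm_scale_mult_right: "F * pm_scale c G = pm_scale c (F * G)"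
  for F G :: "('v, 'k::field) mpoly"
  by (simp add: pm_scale_eq_single_mult mult_ac)

definition Var :: "'v \<Rightarrow> ('v, 'k::comm_semiring_1) mpoly" where
  "Var v = Poly_Mapping.single (Poly_Mapping.single v 1) 1"

lemma mp_eval_Var [simp]: "mp_eval (Var v) a = a v"
  by (simp add: Var_def mp_eval_single mono_eval_def)

lemma Var_in_forms: "v \<in> V \<Longrightarrow> Var v \<in> forms V 1"
  by (simp add: Var_def forms_def monoms_def mdeg_def)

definition subst :: "('v, 'k) mpoly \<Rightarrow> ('v \<Rightarrow> ('j, 'k) mpoly) \<Rightarrow> ('j, 'k::field) mpoly" where
  "subst G \<phi> = (\<Sum>m\<in>keys G. pm_scale (lookup G m) (mono_eval m \<phi>))"

lemma mp_eval_mono_eval: "mp_eval (mono_eval m \<phi>) a = mono_eval m (\<lambda>v. mp_eval (\<phi> v) a)"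
  by (simp add: mono_eval_def mp_eval_prod mp_eval_power)

lemma mp_eval_subst: "mp_eval (subst G \<phi>) a = mp_eval G (\<lambda>v. mp_eval (\<phi> v) a)"
  by (simp add: subst_def mp_eval_sum mp_eval_scalar mp_eval_mono_eval mp_eval_def[of G])

lemma forms_0 [simp]: "0 \<in> forms V e"
  by (simp add: forms_def)

lemma forms_1: "1 \<in> forms V 0"
  by (auto simp: forms_def monoms_def mdeg_def)

lemma forms_add: "F \<in> forms V e \<Longrightarrow> G \<in> forms V e \<Longrightarrow> F + G \<in> forms V e"
  using Poly_Mapping.keys_add[of F G] by (auto simp: forms_def)

lemma forms_sum: "(\<And>i. i \<in> I \<Longrightarrow> F i \<in> forms V e) \<Longrightarrow> (\<Sum>i\<in>I. F i) \<in> forms V e"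
  by (induction I rule: infinite_finite_induct) (auto intro: forms_add)

lemma forms_scale: "F \<in> forms V e \<Longrightarrow> pm_scale c F \<in> forms V e"
  by (auto simp: forms_def in_keys_iff)

lemma forms_power:
  fixes F :: "('v, 'k::comm_semiring_1) mpoly"
  assumes "F \<in> forms V e"
  shows "F ^ n \<in> forms V (e * n)"
proof (induction n)
  case (Suc n)
  then show ?case using forms_mult[OF assms Suc] by simp
qed (simp add: forms_1)

text \<open>Subtraction of exponent vectors is truncated; whenever \<open>j\<close> does not occur
  in \<open>m\<close>, the factor \<open>of_nat 0\<close> removes the term.\<close>

definition pd :: "'v \<Rightarrow> ('v, 'k::comm_ring_1) mpoly \<Rightarrow> ('v, 'k) mpoly" where
  "pd j F = (\<Sum>m\<in>keys F. Poly_Mapping.single (m - Poly_Mapping.single j 1)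
     (of_nat (lookup m j) * lookup F m))"

lemma pd_superset:
  assumes "finite S" "keys F \<subseteq> S"
  shows "pd j F = (\<Sum>m\<in>S. Poly_Mapping.single (m - Poly_Mapping.single j 1)
     (of_nat (lookup m j) * lookup F m))"
  unfolding pd_def
  by (rule sum.mono_neutral_left) (use assms in \<open>auto simp: in_keys_iff\<close>)

lemma pd_0 [simp]: "pd j 0 = 0"
  by (simp add: pd_def)

lemma pd_add: "pd j (F + G) = pd j F + pd j G"
proof -
  let ?S = "keys F \<union> keys G"
  have "keys (F + G) \<subseteq> ?S" by (rule Poly_Mapping.keys_add)
  then show ?thesis
    by (simp add: pd_superset[of ?S] lookup_add algebra_simps single_add sum.distrib)
qed

lemma pd_single: "pd j (Poly_Mapping.single m c) =
    Poly_Mapping.single (m - Poly_Mapping.single j 1) (of_nat (lookup m j) * c)"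
  by (simp add: pd_def)

lemma single_minus_add:
  "lookup m j > 0 \<Longrightarrow>
    m - Poly_Mapping.single j (Suc 0) + m' = m + m' - Poly_Mapping.single j (Suc 0)"
  by (rule poly_mapping_eqI) (auto simp: lookup_add lookup_minus lookup_single when_def)

lemma pd_mult: "pd j (F * G) = pd j F * G + F * pd j G"
proof (induction F rule: poly_mapping_add_induct)
  case (add F F')
  then show ?case by (simp add: distrib_right pd_add algebra_simps)
next
  case (single m a)
  show ?case
  proof (induction G rule: poly_mapping_add_induct)
    case (add F F')
    then show ?case by (simp add: distrib_left pd_add algebra_simps)
  next
    case (single m' b)
    let ?r = "m + m' - Poly_Mapping.single j 1"
    have "Poly_Mapping.single (m - Poly_Mapping.single j 1) (of_nat (lookup m j) * a)
        * Poly_Mapping.single m' b = Poly_Mapping.single ?r (of_nat (lookup m j) * a * b)"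
      by (cases "lookup m j = 0") (auto simp: mult_single single_minus_add)
    moreover have "Poly_Mapping.single m a
        * Poly_Mapping.single (m' - Poly_Mapping.single j 1) (of_nat (lookup m' j) * b)
        = Poly_Mapping.single ?r (of_nat (lookup m' j) * a * b)"
    proof (cases "lookup m' j = 0")
      case False
      then show ?thesis
        using single_minus_add[of m' j m] by (simp add: mult_single add.commute mult_ac)
    qed simp
    ultimately show ?case
      by (simp add: pd_single mult_single lookup_add algebra_simps flip: single_add)
  qed simp
qed simp

lemma pd_const [simp]: "pd j (Poly_Mapping.single 0 c) = 0"
  by (simp add: pd_single)

lemma pd_Var: "pd j (Var v) = (if j = v then 1 else 0)"
  by (auto simp: Var_def pd_single lookup_single when_def)

lemma mp_eval_zero:
  fixes F :: "('v, 'k::comm_ring_1) mpoly"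
  shows "mp_eval F (\<lambda>_. 0) = lookup F 0"
proof -
  have "mono_eval m (\<lambda>_. 0) = (if m = 0 then 1 else (0 :: 'k))" for m :: "'v \<Rightarrow>\<^sub>0 nat"
    by (auto simp: mono_eval_def in_keys_iff power_0_left poly_mapping_eq_iff fun_eq_iff
        intro!: prod_zero)
  then have "mp_eval F (\<lambda>_. 0) = (\<Sum>m\<in>insert 0 (keys F). if m = 0 then lookup F m else 0)"
    by (subst mp_eval_superset[of "insert 0 (keys F)"])
      (auto intro!: sum.cong simp: if_distrib[of "(*) _"] simp del: sum.insert_if cong: if_cong)
  also have "\<dots> = lookup F 0"
    by (subst sum.delta) auto
  finally show ?thesis .
qed

lemma lookup_pd_0: "lookup (pd j F) 0 = lookup F (Poly_Mapping.single j 1)"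
proof (induction F rule: poly_mapping_add_induct)
  case (single m c)
  show ?case
  proof (cases "m = Poly_Mapping.single j 1 \<or> lookup m j = 0")
    case True
    then show ?thesis by (auto simp: pd_single lookup_single when_def)
  next
    case False
    have "m - Poly_Mapping.single j 1 \<noteq> 0"
    proof
      assume eq: "m - Poly_Mapping.single j 1 = 0"
      have "lookup m v = lookup (Poly_Mapping.single j 1) v" for v
        using False arg_cong[OF eq, of "\<lambda>p. lookup p v"]
        by (cases "v = j") (auto simp: lookup_minus lookup_single)
      then show False using False by (metis poly_mapping_eqI)
    qed
    then show ?thesis using False by (auto simp: pd_single lookup_single when_def)
  qed
qed (simp_all add: pd_add lookup_add)

text \<open>Over a field of characteristic zero polynomials are determined by their values, so the
  substitution laws below become pointwise computations.\<close>

lemma mpoly_eqI: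
  fixes F G :: "('v, 'k::field_char_0) mpoly"
  assumes "\<And>a. mp_eval F a = mp_eval G a"
  shows "F = G"
  using mp_eval_eq_0_imp_0[of "F - G"] assms by (simp add: mp_eval_diff)

lemma subst_mult: "subst (F * G) \<phi> = subst F \<phi> * subst G \<phi>"
  for \<phi> :: "'v \<Rightarrow> ('j, 'k::field_char_0) mpoly"
  by (rule mpoly_eqI) (simp add: mp_eval_mult mp_eval_subst)

lemma subst_power: "subst (F ^ n) \<phi> = subst F \<phi> ^ n"
  for \<phi> :: "'v \<Rightarrow> ('j, 'k::field_char_0) mpoly"
  by (rule mpoly_eqI) (simp add: mp_eval_power mp_eval_subst)

lemma subst_prod: "subst (\<Prod>i\<in>I. F i) \<phi> = (\<Prod>i\<in>I. subst (F i) \<phi>)"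
  for \<phi> :: "'v \<Rightarrow> ('j, 'k::field_char_0) mpoly"
  by (rule mpoly_eqI) (simp add: mp_eval_prod mp_eval_subst)

lemma subst_lincomb: "subst (\<Sum>i\<in>I. pm_scale (c i) (F i)) \<phi> = (\<Sum>i\<in>I. pm_scale (c i) (subst (F i) \<phi>))"
  for \<phi> :: "'v \<Rightarrow> ('j, 'k::field_char_0) mpoly"
  by (rule mpoly_eqI) (simp add: mp_eval_sum mp_eval_scalar mp_eval_subst)

lemma subst_Var: "subst (Var v) \<phi> = \<phi> v"
  for \<phi> :: "'v \<Rightarrow> ('j, 'k::field_char_0) mpoly"
  by (rule mpoly_eqI) (simp add: mp_eval_subst)

section \<open>Counting dimensions\<close>

text \<open>Repeated members are excluded by the relation with coefficients 1 and -1, so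
  independence of a family passes to the set of its members without loss in cardinality.\<close>

lemma independent_family:
  fixes b :: "'i \<Rightarrow> ('v \<Rightarrow>\<^sub>0 'k::field)"
  assumes "finite I"
    and indep: "\<And>c. (\<Sum>i\<in>I. pm_scale (c i) (b i)) = 0 \<Longrightarrow> \<forall>i\<in>I. c i = 0"
  shows "inj_on b I" "pm.independent (b ` I)"
proof -
  show inj: "inj_on b I"
  proof (rule inj_onI, rule ccontr)
    fix i j assume ij: "i \<in> I" "j \<in> I" "b i = b j" "i \<noteq> j"
    define c :: "'i \<Rightarrow> 'k" where "c = (\<lambda>_. 0)(i := 1, j := -1)"
    have "(\<Sum>x\<in>I. pm_scale (c x) (b x)) = (\<Sum>x\<in>{i, j}. pm_scale (c x) (b x))"
      by (rule sum.mono_neutral_right) (use assms(1) ij in \<open>auto simp: c_def\<close>)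
    also have "\<dots> = 0"
      using ij by (simp add: c_def)
    finally have "c i = 0" using indep ij by blast
    then show False using ij by (simp add: c_def)
  qed
  show "pm.independent (b ` I)"
    unfolding pm.independent_explicit_finite_subsets
  proof (intro allI impI ballI)
    fix A u v assume A: "A \<subseteq> b ` I" "finite A" "(\<Sum>v\<in>A. pm_scale (u v) v) = 0" "v \<in> A"
    define c where "c = (\<lambda>i. if b i \<in> A then u (b i) else 0)"
    have "(\<Sum>i\<in>I. pm_scale (c i) (b i)) = (\<Sum>v\<in>b ` I. pm_scale (if v \<in> A then u v else 0) v)"
      by (subst sum.reindex[OF inj]) (simp add: c_def)
    also have "\<dots> = (\<Sum>v\<in>A. pm_scale (if v \<in> A then u v else 0) v)"
      by (rule sum.mono_neutral_right) (use assms(1) A in auto)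
    also have "\<dots> = 0"
      using A(3) by (simp cong: sum.cong)
    finally have "\<forall>i\<in>I. c i = 0" by (rule indep)
    then show "u v = 0" using A by (force simp: c_def)
  qed
qed

lemma card_le_of_independent_family:
  fixes b :: "'i \<Rightarrow> ('v \<Rightarrow>\<^sub>0 'k::field)"
  assumes "finite I" "finite T" "\<And>i. i \<in> I \<Longrightarrow> b i \<in> pm.span T"
    and indep: "\<And>c. (\<Sum>i\<in>I. pm_scale (c i) (b i)) = 0 \<Longrightarrow> \<forall>i\<in>I. c i = 0"
  shows "card I \<le> card T"
proof -
  have inj: "inj_on b I" and "pm.independent (b ` I)"
    using independent_family[OF assms(1) indep] by auto
  then have "card (b ` I) \<le> card T"
    using pm.independent_span_bound[of T "b ` I"] assms by blast
  then show ?thesis by (simp add: card_image inj)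
qed

text \<open>Bounding every exponent separately, instead of the total degree, gives the clean count
  \<open>(B + 1) ^ card J\<close> with the same order of growth in \<open>B\<close>, and the bounds
  add under products.\<close>

definition expos :: "'j set \<Rightarrow> nat \<Rightarrow> ('j \<Rightarrow>\<^sub>0 nat) set" where
  "expos J B = {m. keys m \<subseteq> J \<and> (\<forall>j. lookup m j \<le> B)}"

definition poly_box :: "'j set \<Rightarrow> nat \<Rightarrow> ('j, 'k::zero) mpoly set" where
  "poly_box J B = {F. keys F \<subseteq> expos J B}"

lemma finite_card_expos:
  assumes "finite J"
  shows "finite (expos J B)" and "card (expos J B) \<le> (B + 1) ^ card J"
proof -
  let ?h = "\<lambda>m. restrict (lookup m) J"
  have inj: "inj_on ?h (expos J B)"
  proof (rule inj_onI, rule poly_mapping_eqI)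
    fix m m' j assume m: "m \<in> expos J B" "m' \<in> expos J B" "?h m = ?h m'"
    show "lookup m j = lookup m' j"
    proof (cases "j \<in> J")
      case True
      then show ?thesis using fun_cong[OF m(3), of j] by simp
    next
      case False
      then have "j \<notin> keys m" "j \<notin> keys m'" using m(1,2) by (auto simp: expos_def)
      then show ?thesis by (simp add: in_keys_iff)
    qed
  qed
  have sub: "?h ` expos J B \<subseteq> (\<Pi>\<^sub>E j\<in>J. {..B})"
    by (auto simp: expos_def)
  have fin: "finite (\<Pi>\<^sub>E j\<in>J. {..B})"
    by (rule finite_PiE) (use assms in auto)
  show "finite (expos J B)"
    using inj sub fin by (meson finite_imageD finite_subset)
  have "card (expos J B) \<le> card (\<Pi>\<^sub>E j\<in>J. {..B})"
    using inj sub fin by (metis card_image card_mono)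
  then show "card (expos J B) \<le> (B + 1) ^ card J"
    using assms by (simp add: card_PiE)
qed

lemma box_span: "F \<in> poly_box J B \<Longrightarrow> F \<in> pm.span ((\<lambda>m. Poly_Mapping.single m 1) ` expos J B)"
proof -
  assume F: "F \<in> poly_box J B"
  have "(\<Sum>m\<in>keys F. pm_scale (lookup F m) (Poly_Mapping.single m 1))
      \<in> pm.span ((\<lambda>m. Poly_Mapping.single m 1) ` expos J B)"
    using F by (intro pm.span_sum pm.span_scale pm.span_base) (auto simp: poly_box_def)
  moreover have "pm_scale (lookup F m) (Poly_Mapping.single m 1) = Poly_Mapping.single m (lookup F m)"
    for m by (rule poly_mapping_eqI) (simp add: lookup_single when_def)
  ultimately show ?thesis using poly_mapping_sum_single[of F] by simp
qed

lemma card_le_of_independent_box: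
  assumes "finite J" "finite I" "\<And>i. i \<in> I \<Longrightarrow> b i \<in> poly_box J B"
    and "\<And>c. (\<Sum>i\<in>I. pm_scale (c i) (b i)) = 0 \<Longrightarrow> \<forall>i\<in>I. c i = 0"
  shows "card I \<le> (B + 1) ^ card J"
proof -
  have "card I \<le> card ((\<lambda>m. Poly_Mapping.single m 1 :: ('a, 'c) mpoly) ` expos J B)"
    by (rule card_le_of_independent_family[of _ _ b])
      (use assms finite_card_expos[of J B] in \<open>auto intro: box_span\<close>)
  also have "\<dots> \<le> card (expos J B)"
    by (rule card_image_le) (use finite_card_expos[of J B] assms in auto)
  finally show ?thesis using finite_card_expos[of J B] assms by linarith
qed

lemma box_0 [simp]: "0 \<in> poly_box J B"
  by (simp add: poly_box_def)

lemma box_const: "Poly_Mapping.single 0 c \<in> poly_box J B"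
  by (auto simp: poly_box_def expos_def)

lemma box_1: "1 \<in> poly_box J B"
  by (auto simp: poly_box_def expos_def)

lemma box_mono: "F \<in> poly_box J B \<Longrightarrow> B \<le> B' \<Longrightarrow> F \<in> poly_box J B'"
  unfolding poly_box_def expos_def by (auto intro: order_trans)

lemma box_add: "F \<in> poly_box J B \<Longrightarrow> G \<in> poly_box J B \<Longrightarrow> F + G \<in> poly_box J B"
  using Poly_Mapping.keys_add[of F G] by (auto simp: poly_box_def)

lemma box_sum: "(\<And>i. i \<in> I \<Longrightarrow> F i \<in> poly_box J B) \<Longrightarrow> (\<Sum>i\<in>I. F i) \<in> poly_box J B"
  by (induction I rule: infinite_finite_induct) (auto intro: box_add)

lemma box_scale: "F \<in> poly_box J B \<Longrightarrow> pm_scale c F \<in> poly_box J B"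
  by (auto simp: poly_box_def in_keys_iff subset_iff)

lemma box_mult:
  fixes F :: "('j, 'k::semiring_0) mpoly"
  assumes "F \<in> poly_box J B" "G \<in> poly_box J B'"
  shows "F * G \<in> poly_box J (B + B')"
  unfolding poly_box_def mem_Collect_eq
proof
  fix m assume "m \<in> keys (F * G)"
  then obtain a b where ab: "a \<in> keys F" "b \<in> keys G" "m = a + b"
    using keys_mult[of F G] by blast
  then have "a \<in> expos J B" "b \<in> expos J B'"
    using assms by (auto simp: poly_box_def)
  then show "m \<in> expos J (B + B')"
    using Poly_Mapping.keys_add[of a b] unfolding expos_def ab(3)
    by (auto simp: lookup_add add_mono)
qed

lemma box_prod:
  fixes F :: "'i \<Rightarrow> ('j, 'k::comm_semiring_1) mpoly"
  shows "(\<And>i. i \<in> I \<Longrightarrow> F i \<in> poly_box J (B i)) \<Longrightarrow> (\<Prod>i\<in>I. F i) \<in> poly_box J (\<Sum>i\<in>I. B i)"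
  by (induction I rule: infinite_finite_induct) (auto intro: box_mult box_1)

lemma box_power:
  fixes F :: "('j, 'k::comm_semiring_1) mpoly"
  shows "F \<in> poly_box J B \<Longrightarrow> F ^ n \<in> poly_box J (n * B)"
  by (induction n) (auto intro: box_mult box_1)

lemma box_Var: "j \<in> J \<Longrightarrow> Var j \<in> poly_box J 1"
  by (auto simp: Var_def poly_box_def expos_def lookup_single when_def)

lemma subst_box:
  assumes "G \<in> forms V e" "\<And>v. v \<in> V \<Longrightarrow> \<phi> v \<in> poly_box J D"
  shows "subst G \<phi> \<in> poly_box J (D * e)"
  unfolding subst_def
proof (intro box_sum box_scale)
  fix m assume "m \<in> keys G"
  then have m: "keys m \<subseteq> V" "mdeg m = e"
    using assms(1) by (auto simp: forms_def monoms_def)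
  have "(\<Prod>v\<in>keys m. \<phi> v ^ lookup m v) \<in> poly_box J (\<Sum>v\<in>keys m. lookup m v * D)"
    by (intro box_prod box_power) (use m assms in auto)
  then show "mono_eval m \<phi> \<in> poly_box J (D * e)"
    using m(2) by (simp add: mono_eval_def mdeg_def mult.commute flip: sum_distrib_left)
qed

section \<open>Hilbert functions of cones\<close>

definition vanish :: "('v \<Rightarrow>\<^sub>0 'k) set \<Rightarrow> ('v, 'k::field) mpoly \<Rightarrow> bool" where
  "vanish C F \<longleftrightarrow> (\<forall>f\<in>C. mp_eval F (lookup f) = 0)"

text \<open>\<open>hilbert_ge C V e m\<close> says that the degree \<open>e\<close> part of the homogeneous coordinate ring of the
  cone \<open>C\<close> has dimension at least \<open>m\<close>.\<close>

definition hilbert_ge :: "('v \<Rightarrow>\<^sub>0 'k::field) set \<Rightarrow> 'v set \<Rightarrow> nat \<Rightarrow> nat \<Rightarrow> bool" where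
  "hilbert_ge C V e m \<longleftrightarrow> (\<exists>F :: nat \<Rightarrow> ('v, 'k) mpoly. (\<forall>i<m. F i \<in> forms V e) \<and>
     (\<forall>c. vanish C (\<Sum>i<m. pm_scale (c i) (F i)) \<longrightarrow> (\<forall>i<m. c i = 0)))"

lemma hilbert_geI:
  assumes "finite I" "\<And>i. i \<in> I \<Longrightarrow> F i \<in> forms V e"
    and indep: "\<And>c. vanish C (\<Sum>i\<in>I. pm_scale (c i) (F i)) \<Longrightarrow> \<forall>i\<in>I. c i = 0"
  shows "hilbert_ge C V e (card I)"
proof -
  obtain h where h: "bij_betw h {..<card I} I"
    using ex_bij_betw_nat_finite[OF assms(1)] by (auto simp: atLeast0LessThan)
  show ?thesis
    unfolding hilbert_ge_def
  proof (intro exI[of _ "F \<circ> h"] conjI allI impI)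
    fix i assume "i < card I"
    then show "(F \<circ> h) i \<in> forms V e"
      using h assms(2) by (auto simp: bij_betw_def)
  next
    fix c i assume v: "vanish C (\<Sum>i<card I. pm_scale (c i) ((F \<circ> h) i))" and i: "i < card I"
    let ?c = "c \<circ> inv_into {..<card I} h"
    have "(\<Sum>i\<in>I. pm_scale (?c i) (F i)) = (\<Sum>i<card I. pm_scale (?c (h i)) (F (h i)))"
      by (rule sum.reindex_bij_betw[OF h, symmetric])
    also have "\<dots> = (\<Sum>i<card I. pm_scale (c i) ((F \<circ> h) i))"
      by (rule sum.cong) (use h in \<open>auto simp: bij_betw_def\<close>)
    finally have "\<forall>i\<in>I. ?c i = 0" using indep[of ?c] v by simp
    moreover have "h i \<in> I" using h i by (auto simp: bij_betw_def)
    ultimately have "?c (h i) = 0" by blast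
    moreover have "inv_into {..<card I} h (h i) = i"
      by (rule inv_into_f_f) (use h i in \<open>auto simp: bij_betw_def\<close>)
    ultimately show "c i = 0" by simp
  qed
qed

lemma hilbert_ge_mono: "hilbert_ge C V e m \<Longrightarrow> C \<subseteq> C' \<Longrightarrow> hilbert_ge C' V e m"
  unfolding hilbert_ge_def vanish_def by blast

text \<open>By \<open>van\<close>, pulling back along \<open>\<phi>\<close> keeps forms independent
  that are independent on \<open>C\<close>, and the pullbacks are polynomials in
  \<open>card J\<close> parameters with exponents at most \<open>D * e\<close>.\<close>

lemma hilbert_ge_upper:
  fixes \<phi> :: "'v \<Rightarrow> ('j, 'k::field_char_0) mpoly"
  assumes "finite J" "\<And>v. v \<in> V \<Longrightarrow> \<phi> v \<in> poly_box J D"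
    and van: "\<And>G. G \<in> forms V e \<Longrightarrow> subst G \<phi> = 0 \<Longrightarrow> vanish C G"
    and "hilbert_ge C V e m"
  shows "m \<le> (D * e + 1) ^ card J"
proof -
  obtain F where F: "\<forall>i<m. F i \<in> forms V e"
    "\<forall>c. vanish C (\<Sum>i<m. pm_scale (c i) (F i)) \<longrightarrow> (\<forall>i<m. c i = 0)"
    using assms(4) unfolding hilbert_ge_def by blast
  have "card {..<m} \<le> (D * e + 1) ^ card J"
  proof (rule card_le_of_independent_box[of _ _ "\<lambda>i. subst (F i) \<phi>"])
    fix c assume "(\<Sum>i<m. pm_scale (c i) (subst (F i) \<phi>)) = 0"
    then have "subst (\<Sum>i<m. pm_scale (c i) (F i)) \<phi> = 0"
      by (simp add: subst_lincomb)
    then have "vanish C (\<Sum>i<m. pm_scale (c i) (F i))"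
      by (intro van forms_sum forms_scale) (use F in auto)
    then show "\<forall>i\<in>{..<m}. c i = 0" using F(2) by blast
  next
    show "subst (F i) \<phi> \<in> poly_box J (D * e)" if "i \<in> {..<m}" for i
      by (rule subst_box[of _ V]) (use that F assms in auto)
  qed (use assms in auto)
  then show ?thesis by simp
qed

section \<open>Derivations\<close>

text \<open>Linearity over a base field is left out because the same notion is applied to
  \<open>Poly_Mapping.map D\<close>, which moves coefficients.\<close>

definition derivation :: "('r::comm_ring_1 \<Rightarrow> 'r) \<Rightarrow> bool" where
  "derivation D \<longleftrightarrow> (\<forall>f g. D (f + g) = D f + D g) \<and> (\<forall>f g. D (f * g) = D f * g + f * D g)"

lemma derivation_pd: "derivation (pd j)"
  by (simp add: derivation_def pd_add pd_mult)

context
  fixes D :: "'r::comm_ring_1 \<Rightarrow> 'r"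
  assumes D: "derivation D"
begin

lemma derivation_add: "D (f + g) = D f + D g"
  and derivation_mult: "D (f * g) = D f * g + f * D g"
  using D by (auto simp: derivation_def)

lemma derivation_0: "D 0 = 0"
  using derivation_add[of 0 0] by simp

lemma derivation_1: "D 1 = 0"
  using derivation_mult[of 1 1] by simp

lemma derivation_sum: "D (\<Sum>i\<in>I. f i) = (\<Sum>i\<in>I. D (f i))"
  by (induction I rule: infinite_finite_induct) (simp_all add: derivation_0 derivation_add)

lemma derivation_of_nat_mult: "D (of_nat n * f) = of_nat n * D f"
  by (induction n) (simp_all add: derivation_0 derivation_add distrib_right)

lemma derivation_power: "D (f ^ n) = of_nat n * f ^ (n - 1) * D f"
proof (induction n)
  case (Suc n)
  then show ?case
    by (cases n) (simp_all add: derivation_1 derivation_mult algebra_simps)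
qed (simp add: derivation_1)

lemma derivation_prod:
  assumes "finite I"
  shows "D (\<Prod>i\<in>I. f i) = (\<Sum>i\<in>I. D (f i) * (\<Prod>j\<in>I - {i}. f j))"
  using assms
proof (induction I rule: finite_induct)
  case (insert x I)
  have "(\<Prod>j\<in>insert x I - {i}. f j) = f x * (\<Prod>j\<in>I - {i}. f j)" if "i \<in> I" for i
  proof -
    have "insert x I - {i} = insert x (I - {i})" using that insert by auto
    then show ?thesis using insert by simp
  qed
  moreover have "insert x I - {x} = I" using insert by auto
  ultimately show ?case
    using insert by (simp add: derivation_mult sum_distrib_left mult_ac)
qed (simp add: derivation_1)

text \<open>Eigenvalues add under products; written as natural multiples of one
  \<open>\<kappa>\<close>, their multiplicity counts the degree of a form.\<close>

lemma derivation_eigen_mult: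
  assumes "D f = of_nat m * \<kappa> * f" "D g = of_nat n * \<kappa> * g"
  shows "D (f * g) = of_nat (m + n) * \<kappa> * (f * g)"
  using assms by (simp add: derivation_mult algebra_simps)

lemma derivation_eigen_mono_eval:
  assumes "\<And>v. v \<in> keys m \<Longrightarrow> D (\<phi> v) = \<kappa> * \<phi> v"
  shows "D (mono_eval m \<phi>) = of_nat (mdeg m) * \<kappa> * mono_eval m \<phi>"
proof -
  have pow: "D (\<phi> v ^ n) = of_nat n * \<kappa> * \<phi> v ^ n" if "v \<in> keys m" for v n
    using derivation_eigen_mult[of "\<phi> v" 1 \<kappa> "\<phi> v ^ _"] assms[OF that]
    by (induction n) (simp_all add: derivation_1)
  have "D (\<Prod>v\<in>S. \<phi> v ^ lookup m v) = of_nat (\<Sum>v\<in>S. lookup m v) * \<kappa> * (\<Prod>v\<in>S. \<phi> v ^ lookup m v)"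
    if "finite S" "S \<subseteq> keys m" for S
    using that
  proof (induction S rule: finite_induct)
    case (insert x S)
    then show ?case
      using derivation_eigen_mult[OF pow[of x "lookup m x"] insert.IH] by simp
  qed (simp add: derivation_1)
  from this[of "keys m"] show ?thesis by (simp add: mono_eval_def mdeg_def)
qed

end

text \<open>Applying \<open>D - \<kappa>\<close> lowers the degree in \<open>X\<close> of a relation.\<close>

lemma twisted_independent:
  fixes D :: "'r::{idom, ring_char_0} \<Rightarrow> 'r"
  assumes D: "derivation D" and "D X \<noteq> 0"
  shows "(\<And>i. i < L \<Longrightarrow> D (S i) = \<kappa> * S i) \<Longrightarrow> (\<Sum>i<L. X ^ i * S i) = 0 \<Longrightarrow> i < L \<Longrightarrow> S i = 0"
proof (induction L arbitrary: S i)
  case (Suc L)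
  have "0 = D (\<Sum>i<Suc L. X ^ i * S i) - \<kappa> * (\<Sum>i<Suc L. X ^ i * S i)"
    using Suc.prems(2) derivation_0[OF D] by (simp del: sum.lessThan_Suc)
  also have "\<dots> = (\<Sum>i<Suc L. of_nat i * X ^ (i - 1) * D X * S i)"
    using Suc.prems(1)
    by (simp add: derivation_sum[OF D] derivation_mult[OF D] derivation_power[OF D]
        sum_distrib_left algebra_simps flip: sum_subtractf del: sum.lessThan_Suc)
  also have "\<dots> = D X * (\<Sum>i<L. X ^ i * (of_nat (Suc i) * S (Suc i)))"
    by (subst sum.lessThan_Suc_shift) (simp add: sum_distrib_left mult_ac del: of_nat_Suc)
  \<comment> \<open>Since \<open>D - \<kappa>\<close> sends \<open>X ^ i * S i\<close> to
    \<open>i * X ^ (i - 1) * D X * S i\<close>, cancelling \<open>D X\<close> leaves a relation with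
    one term fewer. Its coefficients are integer multiples of eigenvectors, hence eigenvectors for
    the same \<open>\<kappa>\<close>, and characteristic zero allows the integers to be cancelled
    afterwards.\<close>
  finally have rel: "(\<Sum>i<L. X ^ i * (of_nat (Suc i) * S (Suc i))) = 0"
    using \<open>D X \<noteq> 0\<close> by simp
  have eig: "D (of_nat (Suc i) * S (Suc i)) = \<kappa> * (of_nat (Suc i) * S (Suc i))" if "i < L" for i
    using Suc.prems(1)[of "Suc i"] that
    by (simp add: derivation_of_nat_mult[OF D] mult_ac del: of_nat_Suc)
  have "of_nat (Suc i) * S (Suc i) = 0" if "i < L" for i
    using Suc.IH[of "\<lambda>i. of_nat (Suc i) * S (Suc i)", OF eig rel] that by blast
  then have pos: "S (Suc i) = 0" if "i < L" for i
    using that by (metis mult_eq_0_iff of_nat_eq_0_iff nat.distinct(1))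
  have "S 0 = 0"
    using Suc.prems(2) pos by (subst (asm) sum.lessThan_Suc_shift) simp
  then show ?case using pos Suc.prems(3) by (cases i) auto
qed simp

text \<open>Pullbacks of degree \<open>e\<close> forms are all eigenvectors for
  \<open>e * \<kappa>\<close>, so the powers of a variable moved by \<open>D\<close> are independent
  over them. The first \<open>L\<close> powers multiply the number of independent polynomials by
  \<open>L\<close>, while the exponents grow by at most \<open>L\<close>.\<close>

lemma hilbert_ge_upper_derivation:
  fixes \<phi> :: "'v \<Rightarrow> ('j::linorder, 'k::field_char_0) mpoly"
  assumes "finite J" "\<And>v. v \<in> V \<Longrightarrow> \<phi> v \<in> poly_box J B"
    and van: "\<And>G. G \<in> forms V e \<Longrightarrow> subst G \<phi> = 0 \<Longrightarrow> vanish C G"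
    and hge: "hilbert_ge C V e m"
    and D: "derivation D" and const: "\<And>c. D (Poly_Mapping.single 0 c) = 0"
    and eig: "\<And>v. v \<in> V \<Longrightarrow> D (\<phi> v) = \<kappa> * \<phi> v"
    and j: "j \<in> J" "D (Var j) \<noteq> 0"
  shows "L * m \<le> (B * e + L + 1) ^ card J"
proof -
  obtain F where F: "\<forall>i<m. F i \<in> forms V e"
    "\<forall>c. vanish C (\<Sum>i<m. pm_scale (c i) (F i)) \<longrightarrow> (\<forall>i<m. c i = 0)"
    using hge unfolding hilbert_ge_def by blast
  have scale: "D (pm_scale c f) = pm_scale c (D f)" for c f
    by (simp add: pm_scale_eq_single_mult derivation_mult[OF D] const)
  have D_subst: "D (subst G \<phi>) = of_nat e * \<kappa> * subst G \<phi>" if G: "G \<in> forms V e" for G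
  proof -
    have "D (mono_eval p \<phi>) = of_nat e * \<kappa> * mono_eval p \<phi>" if "p \<in> keys G" for p
    proof -
      have p: "keys p \<subseteq> V" "mdeg p = e"
        using G that by (auto simp: forms_def monoms_def)
      then show ?thesis
        using derivation_eigen_mono_eval[OF D, of p \<phi> \<kappa>] eig by auto
    qed
    then show ?thesis
      by (simp add: subst_def derivation_sum[OF D] scale sum_distrib_left pm_scale_mult_right)
  qed
  let ?I = "{..<L} \<times> {..<m}"
  have "card ?I \<le> (B * e + L + 1) ^ card J"
  proof (rule card_le_of_independent_box[of _ _ "\<lambda>(i, u). Var j ^ i * subst (F u) \<phi>"])
    fix c assume c: "(\<Sum>x\<in>?I. pm_scale (c x) (case x of (i, u) \<Rightarrow> Var j ^ i * subst (F u) \<phi>)) = 0"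
    define G where "G i = (\<Sum>u<m. pm_scale (c (i, u)) (F u))" for i
    have G: "G i \<in> forms V e" for i
      unfolding G_def by (intro forms_sum forms_scale) (use F in auto)
    have "(\<Sum>i<L. Var j ^ i * subst (G i) \<phi>) = 0"
      using c by (simp add: G_def subst_lincomb sum_distrib_left pm_scale_mult_right
          sum.cartesian_product split_def)
    then have "subst (G i) \<phi> = 0" if "i < L" for i
      using twisted_independent[OF D j(2), of L "\<lambda>i. subst (G i) \<phi>"] D_subst[OF G] that by blast
    then have "vanish C (G i)" if "i < L" for i
      using van G that by blast
    then have "\<forall>u<m. c (i, u) = 0" if "i < L" for i
      using F(2)[rule_format, of "\<lambda>u. c (i, u)"] that unfolding G_def by simp
    then show "\<forall>x\<in>?I. c x = 0" by auto
  next
    fix x assume x: "x \<in> ?I"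
    then obtain i u where iu: "x = (i, u)" "i < L" "u < m" by auto
    have "Var j ^ i * subst (F u) \<phi> \<in> poly_box J (i * 1 + B * e)"
      by (intro box_mult box_power box_Var subst_box[of _ V]) (use iu F assms in auto)
    then show "(case x of (i, u) \<Rightarrow> Var j ^ i * subst (F u) \<phi>) \<in> poly_box J (B * e + L)"
      using iu by (auto elim: box_mono)
  qed (use assms in auto)
  then show ?thesis by simp
qed

section \<open>Chains of irreducible closed sets and Hilbert functions\<close>

text \<open>\<open>C\<close> is any set of representative vectors; testing forms only makes the
  result insensitive to rescaling them.\<close>

definition proj_closure :: "'v set \<Rightarrow> ('v \<Rightarrow>\<^sub>0 'k::field) set \<Rightarrow> ('v \<Rightarrow>\<^sub>0 'k) set set" where
  "proj_closure V C = {P \<in> proj_space V. \<forall>e. \<forall>G\<in>forms V e. vanish C G \<longrightarrow> vanish P G}"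

lemma vanish_Union: "vanish (\<Union>X) G \<longleftrightarrow> (\<forall>P\<in>X. vanish P G)"
  by (auto simp: vanish_def)

lemma vanish_mono: "vanish C' G \<Longrightarrow> C \<subseteq> C' \<Longrightarrow> vanish C G"
  by (auto simp: vanish_def)

lemma vanish_mult: "vanish C F \<or> vanish C G \<Longrightarrow> vanish C (F * G)"
  by (auto simp: vanish_def mp_eval_mult)

lemma not_vanish_power: "\<not> vanish C F \<Longrightarrow> \<not> vanish C (F ^ n)"
  by (auto simp: vanish_def mp_eval_power)

lemma vanish_span: "G \<in> forms V e \<Longrightarrow> vanish (pm.span {f}) G \<longleftrightarrow> mp_eval G (lookup f) = 0"
  unfolding vanish_def by (rule mp_eval_point) (auto simp: pm.span_singleton)

lemma proj_zeros_vanish: "proj_zeros V T = {P \<in> proj_space V. \<forall>F\<in>T. vanish P F}"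
  by (simp add: proj_zeros_def vanish_def)

lemma proj_closure_eq_zeros:
  "proj_closure V C = proj_zeros V {G \<in> (\<Union>e. forms V e). vanish C G}"
  by (auto simp: proj_closure_def proj_zeros_vanish)

lemma closedin_proj_closure: "closedin (zariski V) (proj_closure V C)"
  unfolding closedin_zariski proj_closure_eq_zeros
  by (rule exI[of _ "{G \<in> (\<Union>e. forms V e). vanish C G}"]) auto

lemma proj_closure_vanish:
  "G \<in> forms V e \<Longrightarrow> vanish C G \<Longrightarrow> vanish (\<Union>(proj_closure V C)) G"
  by (auto simp: proj_closure_def vanish_Union)

lemma span_in_proj_closure:
  assumes "f \<in> C" "f \<noteq> 0" "keys f \<subseteq> V"
  shows "pm.span {f} \<in> proj_closure V C"
  unfolding proj_closure_def
proof (intro CollectI conjI allI ballI impI)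
  show "pm.span {f} \<in> proj_space V"
    using assms by (auto simp: proj_space_def)
  fix e G assume "G \<in> forms V e" "vanish C G"
  then show "vanish (pm.span {f}) G"
    using vanish_span[of G V e f] assms(1) by (simp add: vanish_def)
qed

lemma subset_Union_proj_closure:
  assumes "\<And>f. f \<in> C \<Longrightarrow> keys f \<subseteq> V" "f0 \<in> C" "f0 \<noteq> 0"
  shows "C \<subseteq> \<Union>(proj_closure V C)"
proof
  fix f assume f: "f \<in> C"
  show "f \<in> \<Union>(proj_closure V C)"
  proof (cases "f = 0")
    case True
    have "pm.span {f0} \<in> proj_closure V C"
      by (rule span_in_proj_closure) (use assms in auto)
    then show ?thesis using True pm.span_zero by (auto intro: UnionI)
  next
    case False
    have "pm.span {f} \<in> proj_closure V C"
      by (rule span_in_proj_closure) (use assms f False in auto)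
    then show ?thesis using pm.span_base[of f "{f}"] by (auto intro: UnionI)
  qed
qed

lemma closure_of_eq_proj_closure:
  assumes "U \<subseteq> proj_space V"
  shows "zariski V closure_of U = proj_closure V (\<Union>U)"
proof
  have "U \<subseteq> proj_closure V (\<Union>U)"
    using assms by (auto simp: proj_closure_def vanish_def)
  then show "zariski V closure_of U \<subseteq> proj_closure V (\<Union>U)"
    by (intro closure_of_minimal closedin_proj_closure)
next
  obtain T where T: "T \<subseteq> (\<Union>e. forms V e)" "zariski V closure_of U = proj_zeros V T"
    using closedin_closure_of[of "zariski V" U] unfolding closedin_zariski by blast
  have "U \<subseteq> proj_zeros V T"
    using closure_of_subset[of U "zariski V"] assms T(2) by (simp add: topspace_zariski)
  then have "vanish (\<Union>U) F" if "F \<in> T" for F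
    using that by (auto simp: proj_zeros_vanish vanish_Union)
  then show "proj_closure V (\<Union>U) \<subseteq> zariski V closure_of U"
    unfolding T(2) using T(1) by (fastforce simp: proj_zeros_vanish proj_closure_def)
qed

lemma proj_closure_cong:
  assumes "\<And>e G. G \<in> forms V e \<Longrightarrow> vanish C G \<longleftrightarrow> vanish C' G"
  shows "proj_closure V C = proj_closure V C'"
  using assms unfolding proj_closure_def by blast

text \<open>Primality of the homogeneous vanishing ideal, tested on forms. The unit ideal of an
  empty \<open>C\<close> passes as well, so nonemptiness is handled separately.\<close>

definition prime_cone :: "'v set \<Rightarrow> ('v \<Rightarrow>\<^sub>0 'k::field) set \<Rightarrow> bool" where
  "prime_cone V C \<longleftrightarrow> (\<forall>e e' F G. F \<in> forms V e \<longrightarrow> G \<in> forms V e' \<longrightarrow> vanish C (F * G) \<longrightarrow>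
     vanish C F \<or> vanish C G)"

lemma prime_coneD:
  "prime_cone V C \<Longrightarrow> vanish C (F * G) \<Longrightarrow> F \<in> forms V e \<Longrightarrow> G \<in> forms V e' \<Longrightarrow>
    vanish C F \<or> vanish C G"
  unfolding prime_cone_def by blast

lemma irreducible_closed_imp_prime_cone:
  assumes S: "closedin (zariski V) S"
    and Z: "irreducible_closed (subtopology (zariski V) S) Z"
  shows "prime_cone V (\<Union>Z)" "Z \<noteq> {}" "closedin (zariski V) Z"
proof -
  have Z': "closedin (subtopology (zariski V) S) Z"
    using Z by (simp add: irreducible_closed_def)
  show "closedin (zariski V) Z"
    using Z' S by (rule closedin_trans_full)
  show "Z \<noteq> {}"
    using Z by (simp add: irreducible_closed_def)
  have sub: "Z \<subseteq> S" "Z \<subseteq> proj_space V"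
    using Z' closedin_subset by (force simp: topspace_subtopology topspace_zariski)+
  show "prime_cone V (\<Union>Z)"
    unfolding prime_cone_def
  proof (intro allI impI)
    fix e e' F G assume FG: "F \<in> forms V e" "G \<in> forms V e'" "vanish (\<Union>Z) (F * G)"
    have cl: "closedin (subtopology (zariski V) S) (proj_zeros V {H} \<inter> S)"
      if "H \<in> forms V e" for H e
    proof -
      have "closedin (zariski V) (proj_zeros V {H})"
        unfolding closedin_zariski by (rule exI[of _ "{H}"]) (use that in auto)
      then show ?thesis unfolding closedin_subtopology by auto
    qed
    have "Z \<subseteq> (proj_zeros V {F} \<inter> S) \<union> (proj_zeros V {G} \<inter> S)"
    proof
      fix P assume P: "P \<in> Z"
      then obtain f where f: "P = pm.span {f}"
        using sub by (auto simp: proj_space_def)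
      have "vanish P (F * G)"
        using P FG(3) by (simp add: vanish_Union)
      then have "mp_eval (F * G) (lookup f) = 0"
        using vanish_span[OF forms_mult[OF FG(1,2)]] f by simp
      then have "vanish P F \<or> vanish P G"
        using vanish_span[OF FG(1)] vanish_span[OF FG(2)] f by (simp add: mp_eval_mult)
      then show "P \<in> (proj_zeros V {F} \<inter> S) \<union> (proj_zeros V {G} \<inter> S)"
        using P sub by (auto simp: proj_zeros_vanish)
    qed
    then have "Z \<subseteq> proj_zeros V {F} \<inter> S \<or> Z \<subseteq> proj_zeros V {G} \<inter> S"
      using Z cl[OF FG(1)] cl[OF FG(2)] unfolding irreducible_closed_def by blast
    then show "vanish (\<Union>Z) F \<or> vanish (\<Union>Z) G"
      by (auto simp: proj_zeros_vanish vanish_Union)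
  qed
qed

text \<open>Forms vanish on \<open>C\<close> exactly when they vanish on its closure:
  \<open>in_cl\<close> carries the vanishing of a product back to \<open>C\<close>, where primality
  picks a factor, and \<open>proj_closure_vanish\<close> carries that factor forward again.\<close>

lemma prime_cone_imp_irreducible_closed:
  assumes S: "closedin (zariski V) S" and sub: "proj_closure V C \<subseteq> S"
    and ne: "proj_closure V C \<noteq> {}" and prime: "prime_cone V C"
    and in_cl: "C \<subseteq> \<Union>(proj_closure V C)"
  shows "irreducible_closed (subtopology (zariski V) S) (proj_closure V C)"
  unfolding irreducible_closed_def
proof (intro conjI allI impI ne)
  show "closedin (subtopology (zariski V) S) (proj_closure V C)"
    using closedin_proj_closure sub by (metis closedin_subset_topspace)
  fix A B assume AB: "closedin (subtopology (zariski V) S) A \<and> closedin (subtopology (zariski V) S) B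
    \<and> proj_closure V C \<subseteq> A \<union> B"
  then have "closedin (zariski V) A" "closedin (zariski V) B"
    using S closedin_trans_full by blast+
  then obtain T1 T2 where T: "T1 \<subseteq> (\<Union>e. forms V e)" "A = proj_zeros V T1"
    "T2 \<subseteq> (\<Union>e. forms V e)" "B = proj_zeros V T2"
    unfolding closedin_zariski by blast
  show "proj_closure V C \<subseteq> A \<or> proj_closure V C \<subseteq> B"
  proof (rule ccontr)
    have *: "\<exists>F\<in>T. \<not> vanish (\<Union>(proj_closure V C)) F"
      if "\<not> proj_closure V C \<subseteq> proj_zeros V T" for T
      using that by (auto simp: proj_zeros_vanish vanish_Union proj_closure_def)
    assume "\<not> ?thesis"
    then obtain F G where FG: "F \<in> T1" "G \<in> T2" "\<not> vanish (\<Union>(proj_closure V C)) F"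
      "\<not> vanish (\<Union>(proj_closure V C)) G"
      unfolding T(2,4) using *[of T1] *[of T2] by auto
    obtain e e' where e: "F \<in> forms V e" "G \<in> forms V e'"
      using FG T by blast
    have "vanish P (F * G)" if "P \<in> A \<union> B" for P
      using that FG T(2,4) by (intro vanish_mult) (auto simp: proj_zeros_vanish)
    then have "vanish (\<Union>(proj_closure V C)) (F * G)"
      using AB by (auto simp: vanish_Union)
    then have "vanish C (F * G)"
      using in_cl vanish_mono by blast
    then have "vanish C F \<or> vanish C G"
      using prime_coneD[OF prime _ e] by blast
    then show False
      using FG(3,4) proj_closure_vanish e by blast
  qed
qed

text \<open>The forms \<open>G ^ j * H ^ (L - j) * F i\<close> are independent on \<open>C'\<close>: a relation, restricted to
  \<open>C\<close>, shows that its \<open>j = 0\<close> part is zero; then one can divide by \<open>G\<close>.\<close>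

lemma hilbert_ge_step:
  assumes prime: "prime_cone V C" "prime_cone V C'" and sub: "C \<subseteq> C'"
    and G: "G \<in> forms V g" "vanish C G" "\<not> vanish C' G"
    and H: "H \<in> forms V g" "\<not> vanish C H"
    and hge: "hilbert_ge C V e m"
  shows "hilbert_ge C' V (e + g * L) (L * m)"
proof -
  obtain F where F: "\<forall>i<m. F i \<in> forms V e"
    "\<forall>c. vanish C (\<Sum>i<m. pm_scale (c i) (F i)) \<longrightarrow> (\<forall>i<m. c i = 0)"
    using hge unfolding hilbert_ge_def by blast
  define S where "S c j = (\<Sum>i<m. pm_scale (c j i) (F i))" for c :: "nat \<Rightarrow> nat \<Rightarrow> 'b" and j
  have S: "S c j \<in> forms V e" for c j
    unfolding S_def by (intro forms_sum forms_scale) (use F in auto)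
  have forms: "G ^ j * H ^ (N - j) * R \<in> forms V (g * N + e)"
    if "j \<le> N" "R \<in> forms V e" for j N R
  proof -
    have "G ^ j * H ^ (N - j) * R \<in> forms V (g * j + g * (N - j) + e)"
      by (intro forms_mult forms_power G H that)
    then show ?thesis using that(1) by (simp flip: distrib_left)
  qed
  \<comment> \<open>The exponent bound \<open>N\<close> is kept apart from the number
    \<open>l\<close> of terms: dividing by \<open>G\<close> lowers both by one, and
    \<open>l \<le> N\<close> prevents truncation in \<open>N - j\<close>.\<close>
  have main: "\<forall>j<l. \<forall>i<m. c j i = 0"
    if "l \<le> N" "vanish C' (\<Sum>j<l. G ^ j * H ^ (N - j) * S c j)" for l N c
    using that
  proof (induction l arbitrary: N c)
    case (Suc l)
    obtain N' where N: "N = Suc N'" using Suc.prems(1) by (cases N) auto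
    let ?R = "\<Sum>j<l. G ^ j * H ^ (N' - j) * S (\<lambda>j. c (Suc j)) j"
    have R: "?R \<in> forms V (g * N' + e)"
      by (intro forms_sum forms S) (use Suc.prems N in auto)
    have eq: "(\<Sum>j<Suc l. G ^ j * H ^ (N - j) * S c j) = H ^ N * S c 0 + G * ?R"
      by (subst sum.lessThan_Suc_shift) (simp add: N S_def sum_distrib_left mult_ac)
    have "vanish C (H ^ N * S c 0 + G * ?R)"
      using Suc.prems(2) sub vanish_mono unfolding eq by blast
    then have "vanish C (H ^ N * S c 0)"
      using G(2) by (simp add: vanish_def mp_eval_add mp_eval_mult)
    then have "vanish C (S c 0)"
      using prime_coneD[OF prime(1) _ forms_power[OF H(1)] S] not_vanish_power[OF H(2)] by blast
    then have c0: "\<forall>i<m. c 0 i = 0"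
      using F(2) unfolding S_def by blast
    then have "S c 0 = 0" by (simp add: S_def)
    then have "vanish C' (G * ?R)"
      using Suc.prems(2) unfolding eq by simp
    then have "vanish C' ?R"
      using prime_coneD[OF prime(2) _ G(1) R] G(3) by blast
    then have "\<forall>j<l. \<forall>i<m. c (Suc j) i = 0"
      using Suc.IH[of N' "\<lambda>j. c (Suc j)"] Suc.prems(1) N by simp
    then show ?case
      using c0 by (metis less_Suc_eq_0_disj)
  qed simp
  have "hilbert_ge C' V (e + g * L) (card ({..<L} \<times> {..<m}))"
  proof (rule hilbert_geI[where F = "\<lambda>(j, i). G ^ j * H ^ (L - j) * F i"])
    fix x assume "x \<in> {..<L} \<times> {..<m}"
    then show "(case x of (j, i) \<Rightarrow> G ^ j * H ^ (L - j) * F i) \<in> forms V (e + g * L)"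
      using forms[of "fst x" L] F by (auto simp: add.commute)
  next
    fix c :: "nat \<times> nat \<Rightarrow> 'b"
    assume "vanish C' (\<Sum>x\<in>{..<L} \<times> {..<m}.
      pm_scale (c x) (case x of (j, i) \<Rightarrow> G ^ j * H ^ (L - j) * F i))"
    also have "(\<Sum>x\<in>{..<L} \<times> {..<m}. pm_scale (c x) (case x of (j, i) \<Rightarrow> G ^ j * H ^ (L - j) * F i))
        = (\<Sum>j<L. G ^ j * H ^ (L - j) * S (curry c) j)"
      by (simp add: S_def sum_distrib_left pm_scale_mult_right sum.cartesian_product split_def)
    finally show "\<forall>x\<in>{..<L} \<times> {..<m}. c x = 0"
      using main[of L L "curry c"] by auto
  qed simp
  then show ?thesis by simp
qed

definition irreducible_chain :: "'a topology \<Rightarrow> nat \<Rightarrow> (nat \<Rightarrow> 'a set) \<Rightarrow> bool" where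
  "irreducible_chain X m Z \<longleftrightarrow>
     (\<forall>i\<le>m. irreducible_closed X (Z i)) \<and> (\<forall>i<m. Z i \<subset> Z (Suc i))"

text \<open>Every strict inclusion supplies a form that vanishes on the smaller set only, and
  \<open>hilbert_ge_step\<close> turns it into a factor \<open>L\<close> in the count at the price
  of \<open>g * L\<close> in the degree. The start is the constant form 1 on
  \<open>Z 0\<close>.\<close>

lemma hilbert_ge_chain:
  assumes S: "closedin (zariski V) S"
    and chain: "irreducible_chain (subtopology (zariski V) S) m Z"
  shows "\<exists>g. \<forall>L. hilbert_ge (\<Union>(Z m)) V (g * m * L) (L ^ m)"
proof -
  have irr: "prime_cone V (\<Union>(Z i))" "Z i \<noteq> {}" "closedin (zariski V) (Z i)" if "i \<le> m" for i
    using irreducible_closed_imp_prime_cone[OF S] chain that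
    unfolding irreducible_chain_def by blast+
  have "\<exists>G e. G \<in> forms V e \<and> vanish (\<Union>(Z i)) G \<and> \<not> vanish (\<Union>(Z (Suc i))) G" if i: "i < m" for i
  proof -
    obtain T where T: "T \<subseteq> (\<Union>e. forms V e)" "Z i = proj_zeros V T"
      using irr(3)[of i] i unfolding closedin_zariski by auto
    obtain P where P: "P \<in> Z (Suc i)" "P \<notin> Z i"
      using chain i unfolding irreducible_chain_def by blast
    have "Z (Suc i) \<subseteq> proj_space V"
      using closedin_subset[OF irr(3)[of "Suc i"]] i by (simp add: topspace_zariski)
    then obtain G where "G \<in> T" "\<not> vanish P G"
      using P T(2) by (auto simp: proj_zeros_vanish)
    then show ?thesis
      using T P by (fastforce simp: vanish_Union proj_zeros_vanish)
  qed
  then obtain G e where G: "\<And>i. i < m \<Longrightarrow> G i \<in> forms V (e i) \<and> vanish (\<Union>(Z i)) (G i)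
      \<and> \<not> vanish (\<Union>(Z (Suc i))) (G i)"
    by metis
  obtain P where P: "P \<in> Z 0" using irr(2)[of 0] by auto
  then have "P \<in> proj_space V"
    using closedin_subset[OF irr(3)[of 0]] by (auto simp: topspace_zariski)
  then obtain f where f: "P = pm.span {f}" "keys f \<subseteq> V" "f \<noteq> 0"
    by (auto simp: proj_space_def)
  then obtain v where v: "v \<in> V" "lookup f v \<noteq> 0"
    by (metis in_keys_iff keys_eq_empty subset_iff ex_in_conv)
  have fP: "f \<in> P" using f pm.span_base by blast
  have mono: "\<Union>(Z 0) \<subseteq> \<Union>(Z i)" if "i \<le> m" for i
    using that
  proof (induction i)
    case (Suc i)
    then show ?case using chain unfolding irreducible_chain_def by (meson Suc_leD Suc_le_lessD Union_mono psubset_imp_subset subset_trans)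
  qed simp
  have nv: "\<not> vanish (\<Union>(Z i)) (Var v)" if "i \<le> m" for i
    using mono[OF that] P fP v by (force simp: vanish_def)
  \<comment> \<open>The separating forms must share one degree. The coordinate \<open>v\<close> is
    nonzero at a point of \<open>Z 0\<close>, hence vanishes on no member of the chain; by primality
    its powers raise degrees without destroying separation, and \<open>Var v ^ g\<close> also serves
    as the form \<open>H\<close> of \<open>hilbert_ge_step\<close>.\<close>
  define g where "g = (\<Sum>i<m. e i)"
  define G' where "G' i = Var v ^ (g - e i) * G i" for i
  have G': "G' i \<in> forms V g" "vanish (\<Union>(Z i)) (G' i)" "\<not> vanish (\<Union>(Z (Suc i))) (G' i)"
    if i: "i < m" for i
  proof -
    have ei: "e i \<le> g" unfolding g_def by (rule member_le_sum) (use i in auto)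
    have 1: "Var v ^ (g - e i) \<in> forms V (1 * (g - e i))"
      by (intro forms_power Var_in_forms v)
    show "G' i \<in> forms V g"
      using forms_mult[OF 1, of "G i" "e i"] G[OF i] ei by (simp add: G'_def)
    show "vanish (\<Union>(Z i)) (G' i)"
      using G[OF i] unfolding G'_def by (intro vanish_mult) auto
    show "\<not> vanish (\<Union>(Z (Suc i))) (G' i)"
      unfolding G'_def
      using prime_coneD[OF irr(1)[of "Suc i"] _ 1, of "G i" "e i"] G[OF i] i
        not_vanish_power[OF nv[of "Suc i"]] by auto
  qed
  have H: "Var v ^ g \<in> forms V g"
    using forms_power[OF Var_in_forms[OF v(1)], of g] by simp
  have "hilbert_ge (\<Union>(Z k)) V (g * k * L) (L ^ k)" if "k \<le> m" for k L
    using that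
  proof (induction k)
    case 0
    have "hilbert_ge (\<Union>(Z 0)) V 0 (card {()})"
      by (rule hilbert_geI[where F = "\<lambda>_. 1"])
        (use P fP in \<open>auto simp: forms_1 vanish_def mp_eval_scalar\<close>)
    then show ?case by simp
  next
    case (Suc k)
    have "\<Union>(Z k) \<subseteq> \<Union>(Z (Suc k))"
      using chain Suc.prems unfolding irreducible_chain_def by (simp add: Union_mono psubset_imp_subset)
    then have "hilbert_ge (\<Union>(Z (Suc k))) V (g * k * L + g * L) (L * L ^ k)"
      using hilbert_ge_step[OF irr(1) irr(1) _ G' H not_vanish_power[OF nv] Suc.IH] Suc.prems by simp
    then show ?case by (simp add: algebra_simps)
  qed
  then show ?thesis by blast
qed

lemma power_growth:
  fixes m q K :: nat
  assumes "\<And>L. L ^ m \<le> (K * L + 1) ^ q"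
  shows "m \<le> q"
proof (rule ccontr)
  assume "\<not> m \<le> q"
  \<comment> \<open>If \<open>m > q\<close>, the assumption gives
    \<open>L * L ^ q \<le> (K + 1) ^ q * L ^ q\<close>; this \<open>L\<close> is one more than what
    that allows.\<close>
  define L where "L = (K + 1) ^ q + 1"
  have "L ^ Suc q \<le> L ^ m"
    by (rule power_increasing) (use \<open>\<not> m \<le> q\<close> in \<open>auto simp: L_def\<close>)
  also have "\<dots> \<le> (K * L + 1) ^ q" by (rule assms)
  also have "\<dots> \<le> ((K + 1) * L) ^ q"
    by (rule power_mono) (auto simp: L_def)
  finally have "L * L ^ q \<le> (K + 1) ^ q * L ^ q"
    by (simp only: power_mult_distrib power_Suc)
  moreover have "0 < L ^ q" by (simp add: L_def)
  ultimately have "L \<le> (K + 1) ^ q"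
    by (simp only: mult_le_cancel2 simp_thms)
  then show False by (simp add: L_def)
qed

lemma krull_dim_le:
  assumes "\<And>m Z. irreducible_chain X m Z \<Longrightarrow> m \<le> q"
  shows "krull_dim X \<le> enat q"
  unfolding krull_dim_def
  by (rule Sup_least) (use assms in \<open>auto simp: irreducible_chain_def\<close>)

lemma krull_dim_ge:
  assumes "irreducible_chain X q Z"
  shows "enat q \<le> krull_dim X"
  unfolding krull_dim_def
  by (rule Sup_upper) (use assms in \<open>auto simp: irreducible_chain_def\<close>)

text \<open>If all chain lengths were below \<open>q\<close>, they would be at most
  \<open>q - 1\<close>, and so would their supremum. For \<open>q = 0\<close> there may be no chain
  at all, as in the empty space.\<close>

lemma krull_dim_chain:
  assumes "krull_dim X = enat q" "q > 0"
  shows "\<exists>m Z. q \<le> m \<and> irreducible_chain X m Z"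
proof (rule ccontr)
  assume no_chain: "\<not> ?thesis"
  have "m \<le> q - 1" if "irreducible_chain X m Z" for m Z
  proof -
    have "\<not> q \<le> m" using no_chain that by blast
    then show ?thesis by linarith
  qed
  then have "krull_dim X \<le> enat (q - 1)"
    by (rule krull_dim_le)
  then show False using assms by simp
qed

section \<open>Parametrized cones\<close>

text \<open>In every degree the vanishing ideal of \<open>C\<close> is the kernel of the pullback
  along \<open>\<phi>\<close>; this is all that the later arguments use of the image of
  \<open>\<phi>\<close>.\<close>

definition parametrizes :: "'v set \<Rightarrow> ('v \<Rightarrow> ('j, 'k) mpoly) \<Rightarrow> ('v \<Rightarrow>\<^sub>0 'k::field) set \<Rightarrow> bool" where
  "parametrizes V \<phi> C \<longleftrightarrow> (\<forall>e. \<forall>G\<in>forms V e. vanish C G \<longleftrightarrow> subst G \<phi> = 0)"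

lemma parametrizesD: "parametrizes V \<phi> C \<Longrightarrow> G \<in> forms V e \<Longrightarrow> vanish C G \<longleftrightarrow> subst G \<phi> = 0"
  by (auto simp: parametrizes_def)

text \<open>Pulled back forms lie in a polynomial ring, which is an integral domain; the linear
  order on \<open>'j\<close> provides this instance.\<close>

lemma parametrizes_prime_cone:
  fixes \<phi> :: "'v \<Rightarrow> ('j::linorder, 'k::field_char_0) mpoly"
  assumes "parametrizes V \<phi> C"
  shows "prime_cone V C"
  unfolding prime_cone_def
proof (intro allI impI)
  fix e e' F G assume FG: "F \<in> forms V e" "G \<in> forms V e'" "vanish C (F * G)"
  then have "subst F \<phi> * subst G \<phi> = 0"
    using parametrizesD[OF assms forms_mult] by (simp add: subst_mult)
  then show "vanish C F \<or> vanish C G"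
    using parametrizesD[OF assms] FG by auto
qed

subsection \<open>Leading terms\<close>

definition ord_ge :: "nat \<Rightarrow> ('j, 'k::zero) mpoly set" where
  "ord_ge q = {f. \<forall>m\<in>keys f. q \<le> mdeg m}"

text \<open>The part of lowest degree at the origin of the parameter space is the monomial
  \<open>m\<close> with coefficient 1.\<close>

definition leads :: "('j, 'k::comm_ring_1) mpoly \<Rightarrow> ('j \<Rightarrow>\<^sub>0 nat) \<Rightarrow> bool" where
  "leads f m \<longleftrightarrow> f - Poly_Mapping.single m 1 \<in> ord_ge (Suc (mdeg m))"

lemma mdeg_0 [simp]: "mdeg 0 = 0"
  by (simp add: mdeg_def)

lemma ord_ge_add: "f \<in> ord_ge q \<Longrightarrow> g \<in> ord_ge q \<Longrightarrow> f + g \<in> ord_ge q"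
  using Poly_Mapping.keys_add[of f g] by (auto simp: ord_ge_def)

lemma ord_ge_mult: "f \<in> ord_ge q \<Longrightarrow> g \<in> ord_ge q' \<Longrightarrow> f * g \<in> ord_ge (q + q')"
  for f g :: "('j, 'k::semiring_0) mpoly"
  using keys_mult[of f g] by (fastforce simp: ord_ge_def mdeg_add intro: add_mono)

lemma ord_ge_single: "q \<le> mdeg m \<Longrightarrow> Poly_Mapping.single m c \<in> ord_ge q"
  by (auto simp: ord_ge_def)

lemma ord_ge_mono: "f \<in> ord_ge q \<Longrightarrow> q' \<le> q \<Longrightarrow> f \<in> ord_ge q'"
  by (auto simp: ord_ge_def intro: order_trans)

lemma leads_1: "leads 1 0"
  by (simp add: leads_def ord_ge_def flip: single_one)

lemma leads_mult:
  assumes "leads f m" "leads g m'"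
  shows "leads (f * g) (m + m')"
proof -
  define f' where "f' = f - Poly_Mapping.single m 1"
  define g' where "g' = g - Poly_Mapping.single m' 1"
  have f': "f' \<in> ord_ge (Suc (mdeg m))" and g': "g' \<in> ord_ge (Suc (mdeg m'))"
    using assms by (auto simp: leads_def f'_def g'_def)
  have "f * g - Poly_Mapping.single (m + m') 1
      = f' * (g' + Poly_Mapping.single m' 1) + Poly_Mapping.single m 1 * g'"
    by (simp add: f'_def g'_def algebra_simps mult_single)
  also have "\<dots> \<in> ord_ge (Suc (mdeg m) + mdeg m')"
  proof (rule ord_ge_add)
    show "f' * (g' + Poly_Mapping.single m' 1) \<in> ord_ge (Suc (mdeg m) + mdeg m')"
      by (intro ord_ge_mult f' ord_ge_add ord_ge_single ord_ge_mono[OF g']) auto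
    have "Poly_Mapping.single m 1 * g' \<in> ord_ge (mdeg m + Suc (mdeg m'))"
      by (intro ord_ge_mult g' ord_ge_single) auto
    then show "Poly_Mapping.single m 1 * g' \<in> ord_ge (Suc (mdeg m) + mdeg m')" by simp
  qed
  finally show ?thesis by (simp add: leads_def mdeg_add)
qed

lemma leads_prod:
  "finite I \<Longrightarrow> (\<And>i. i \<in> I \<Longrightarrow> leads (f i) (m i)) \<Longrightarrow> leads (\<Prod>i\<in>I. f i) (\<Sum>i\<in>I. m i)"
  by (induction I rule: finite_induct) (auto intro: leads_mult leads_1)

lemma leads_power: "leads f m \<Longrightarrow> leads (f ^ n) (\<Sum>i<n. m)"
  using leads_prod[of "{..<n}" "\<lambda>_. f" "\<lambda>_. m"] by simp

text \<open>Among the terms with nonzero coefficient take one whose leading monomial has least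
  degree. No other term contains this monomial: not as leading monomial, by injectivity, and not in
  a tail, by degree.\<close>

lemma leads_independent:
  fixes f :: "'b \<Rightarrow> ('j, 'k::field) mpoly"
  assumes "finite B" "inj_on m B" "\<And>\<beta>. \<beta> \<in> B \<Longrightarrow> leads (f \<beta>) (m \<beta>)"
    and zero: "(\<Sum>\<beta>\<in>B. pm_scale (c \<beta>) (f \<beta>)) = 0"
  shows "\<forall>\<beta>\<in>B. c \<beta> = 0"
proof (rule ccontr)
  assume "\<not> ?thesis"
  then have "\<exists>\<beta>. \<beta> \<in> B \<and> c \<beta> \<noteq> 0" by auto
  then obtain \<beta> where \<beta>: "\<beta> \<in> B" "c \<beta> \<noteq> 0"
    and min: "\<And>\<beta>'. \<beta>' \<in> B \<and> c \<beta>' \<noteq> 0 \<Longrightarrow> mdeg (m \<beta>) \<le> mdeg (m \<beta>')"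
    using ex_has_least_nat[of "\<lambda>\<beta>. \<beta> \<in> B \<and> c \<beta> \<noteq> 0" _ "\<lambda>\<beta>. mdeg (m \<beta>)"] by blast
  have "c \<beta>' * lookup (f \<beta>') (m \<beta>) = (if \<beta>' = \<beta> then c \<beta> else 0)" if \<beta>': "\<beta>' \<in> B" for \<beta>'
  proof (cases "c \<beta>' = 0")
    case False
    have "m \<beta> \<notin> keys (f \<beta>' - Poly_Mapping.single (m \<beta>') 1)"
      using assms(3)[OF \<beta>'] min[of \<beta>'] \<beta>' False by (force simp: leads_def ord_ge_def)
    then have "lookup (f \<beta>') (m \<beta>) = lookup (Poly_Mapping.single (m \<beta>') 1) (m \<beta>)"
      by (simp add: in_keys_iff lookup_minus)
    then show ?thesis
      using assms(2) \<beta> \<beta>' by (auto simp: lookup_single when_def inj_on_def)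
  qed (use \<beta> in auto)
  then have "(\<Sum>\<beta>'\<in>B. c \<beta>' * lookup (f \<beta>') (m \<beta>)) = c \<beta>"
    using \<beta>(1) assms(1) by (simp cong: sum.cong)
  moreover have "(\<Sum>\<beta>'\<in>B. c \<beta>' * lookup (f \<beta>') (m \<beta>)) = 0"
    using arg_cong[OF zero, of "\<lambda>F. lookup F (m \<beta>)"] by (simp add: lookup_sum)
  ultimately show False using \<beta>(2) by simp
qed

text \<open>The forms \<open>\<Lambda> x\<close> pull back to local coordinates at the origin and
  \<open>M\<close> to a local unit. Monomials in the \<open>\<Lambda> x\<close> with exponents below
  \<open>L\<close>, filled up by powers of \<open>M\<close> to degree \<open>card J * L\<close>,
  therefore have distinct leading monomials.\<close>

lemma hilbert_ge_lower:
  fixes \<phi> :: "'v \<Rightarrow> ('j, 'k::field_char_0) mpoly"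
  assumes par: "parametrizes V \<phi> C" and J: "finite J" "inj_on h J"
    and M: "M \<in> forms V 1" "leads (subst M \<phi>) 0"
    and \<Lambda>: "\<And>x. x \<in> J \<Longrightarrow> \<Lambda> x \<in> forms V 1"
      "\<And>x. x \<in> J \<Longrightarrow> leads (subst (\<Lambda> x) \<phi>) (Poly_Mapping.single (h x) 1)"
  shows "hilbert_ge C V (card J * L) (L ^ card J)"
proof -
  let ?B = "J \<rightarrow>\<^sub>E {..<L}"
  have fin: "finite ?B" using J by (intro finite_PiE) auto
  have card: "card ?B = L ^ card J" using J by (simp add: card_PiE)
  define G where "G \<beta> = M ^ (card J * L - (\<Sum>x\<in>J. \<beta> x)) * (\<Prod>x\<in>J. \<Lambda> x ^ \<beta> x)" for \<beta>
  define m where "m \<beta> = (\<Sum>x\<in>J. \<Sum>i<\<beta> x. Poly_Mapping.single (h x) (1::nat))" for \<beta> :: "_ \<Rightarrow> nat"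
  have prod_forms: "(\<Prod>x\<in>S. \<Lambda> x ^ \<beta> x) \<in> forms V (\<Sum>x\<in>S. \<beta> x)" if "finite S" "S \<subseteq> J" for S \<beta>
    using that
  proof (induction S rule: finite_induct)
    case (insert x S)
    have "\<Lambda> x ^ \<beta> x \<in> forms V (1 * \<beta> x)"
      by (intro forms_power \<Lambda>) (use insert in auto)
    then show ?case using insert forms_mult by fastforce
  qed (simp add: forms_1)
  have G: "G \<beta> \<in> forms V (card J * L)" if "\<beta> \<in> ?B" for \<beta>
  proof -
    have "(\<Sum>x\<in>J. \<beta> x) \<le> (\<Sum>x\<in>J. L)"
      by (rule sum_mono) (use that in force)
    then have "(\<Sum>x\<in>J. \<beta> x) \<le> card J * L" by simp
    then show ?thesis
      using forms_mult[OF forms_power[OF M(1), of "card J * L - (\<Sum>x\<in>J. \<beta> x)"]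
          prod_forms[of J \<beta>]] J by (simp add: G_def)
  qed
  have lead: "leads (subst (G \<beta>) \<phi>) (m \<beta>)" for \<beta>
  proof -
    have "leads (subst (G \<beta>) \<phi>) ((\<Sum>i<card J * L - (\<Sum>x\<in>J. \<beta> x). 0) + m \<beta>)"
      unfolding G_def subst_mult subst_power subst_prod m_def
      by (intro leads_mult leads_power leads_prod M \<Lambda> J)
    then show ?thesis by simp
  qed
  have "lookup (m \<beta>) (h x) = \<beta> x" if x: "x \<in> J" for \<beta> x
  proof -
    have "lookup (m \<beta>) (h x) = (\<Sum>y\<in>J. if y = x then \<beta> y else 0)"
      unfolding m_def lookup_sum
      by (rule sum.cong) (use J x in \<open>auto simp: lookup_single when_def inj_on_def\<close>)
    then show ?thesis using x J by simp
  qed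
  then have inj: "inj_on m ?B"
    by (intro inj_onI PiE_ext) (auto, metis)
  have "hilbert_ge C V (card J * L) (card ?B)"
  proof (rule hilbert_geI[OF fin G])
    fix c assume v: "vanish C (\<Sum>\<beta>\<in>?B. pm_scale (c \<beta>) (G \<beta>))"
    have "(\<Sum>\<beta>\<in>?B. pm_scale (c \<beta>) (G \<beta>)) \<in> forms V (card J * L)"
      by (intro forms_sum forms_scale G)
    then have "(\<Sum>\<beta>\<in>?B. pm_scale (c \<beta>) (subst (G \<beta>) \<phi>)) = 0"
      using parametrizesD[OF par] v by (simp add: subst_lincomb)
    then show "\<forall>\<beta>\<in>?B. c \<beta> = 0"
      by (rule leads_independent[OF fin inj lead])
  qed
  then show ?thesis by (simp add: card)
qed

subsection \<open>Independence at a point\<close>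

lemma dual_coordinates:
  fixes w :: "'i \<Rightarrow> ('v \<Rightarrow>\<^sub>0 'k::field)"
  assumes "finite I" "finite V" "\<And>i. i \<in> I \<Longrightarrow> keys (w i) \<subseteq> V"
    and indep: "\<And>c. (\<Sum>i\<in>I. pm_scale (c i) (w i)) = 0 \<Longrightarrow> \<forall>i\<in>I. c i = 0"
  obtains y where "\<And>i j. i \<in> I \<Longrightarrow> j \<in> I \<Longrightarrow> (\<Sum>v\<in>V. y i v * lookup (w j) v) = (if i = j then 1 else 0)"
proof -
  interpret vp: vector_space_pair "pm_scale :: 'k \<Rightarrow> ('v \<Rightarrow>\<^sub>0 'k) \<Rightarrow> _" "(*) :: 'k \<Rightarrow> _"
    by unfold_locales (auto simp: algebra_simps)
  have inj: "inj_on w I" and ind: "pm.independent (w ` I)"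
    using independent_family[OF assms(1) indep] by auto
  have "\<exists>g. Vector_Spaces.linear pm_scale (*) g \<and> (\<forall>f\<in>w ` I. g f = (if f = w i then 1 else 0))" for i
    by (rule vp.linear_independent_extend[OF ind])
  then obtain g where g: "\<And>i. Vector_Spaces.linear pm_scale (*) (g i)"
    "\<And>i f. f \<in> w ` I \<Longrightarrow> g i f = (if f = w i then 1 else 0 :: 'k)"
    by metis
  define y where "y i v = g i (Poly_Mapping.single v 1)" for i v
  show ?thesis
  proof (rule that)
    fix i j assume ij: "i \<in> I" "j \<in> I"
    have "w j = (\<Sum>v\<in>V. pm_scale (lookup (w j) v) (Poly_Mapping.single v 1))"
      by (rule poly_mapping_eqI)
        (use assms(2) assms(3)[OF ij(2)] in \<open>auto simp: lookup_sum lookup_single when_def in_keys_iff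
          if_distrib[of "(*) _"] cong: if_cong\<close>)
    then have "g i (w j) = (\<Sum>v\<in>V. lookup (w j) v * y i v)"
      by (metis (no_types, lifting) g(1) vp.linear_sum vp.linear_scale y_def sum.cong)
    then show "(\<Sum>v\<in>V. y i v * lookup (w j) v) = (if i = j then 1 else 0)"
      using g(2)[of "w j" i] ij inj_on_eq_iff[OF inj ij] by (auto simp: mult.commute)
  qed
qed

text \<open>Gaussian elimination over the polynomial ring.\<close>

lemma polynomial_relation_or_generic_independence:
  fixes w :: "'i \<Rightarrow> 'v \<Rightarrow> ('j::linorder, 'k::field) mpoly"
  assumes "finite I"
  shows "(\<exists>c. (\<exists>i\<in>I. c i \<noteq> 0) \<and> (\<forall>v. (\<Sum>i\<in>I. c i * w i v) = 0)) \<or>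
    (\<exists>\<Delta>. \<Delta> \<noteq> 0 \<and> (\<forall>p. mp_eval \<Delta> p \<noteq> 0 \<longrightarrow>
      (\<forall>b. (\<forall>v. (\<Sum>i\<in>I. b i * mp_eval (w i v) p) = 0) \<longrightarrow> (\<forall>i\<in>I. b i = 0))))"
    (is "?rel I w \<or> ?ind I w")
  using assms
proof (induction I arbitrary: w rule: finite_induct)
  case empty
  show ?case by (auto intro: exI[of _ 1])
next
  case (insert x I)
  show ?case
  proof (cases "\<forall>v. w x v = 0")
    case True
    have "(\<Sum>i\<in>insert x I. (if i = x then 1 else 0) * w i v) = 0" for v
      by (rule sum.neutral) (use True in auto)
    then have "?rel (insert x I) w"
      by (intro exI[of _ "\<lambda>i. if i = x then 1 else 0"]) auto
    then show ?thesis ..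
  next
    case False
    then obtain u where u: "w x u \<noteq> 0" by blast
    \<comment> \<open>Cross-multiplication with the pivot \<open>w x u\<close> clears the coordinate
      \<open>u\<close> without leaving the polynomial ring.\<close>
    define w' where "w' i v = w x u * w i v - w i u * w x v" for i v
    from insert.IH[of w'] show ?thesis
    proof
      assume "?rel I w'"
      then obtain c where c: "\<exists>i\<in>I. c i \<noteq> 0" "\<And>v. (\<Sum>i\<in>I. c i * w' i v) = 0" by blast
      define c' where "c' i = (if i = x then - (\<Sum>i\<in>I. c i * w i u) else c i * w x u)" for i
      have "(\<Sum>i\<in>insert x I. c' i * w i v) = 0" for v
      proof -
        have "(\<Sum>i\<in>I. c' i * w i v) = (\<Sum>i\<in>I. c i * w x u * w i v)"
          by (rule sum.cong) (use insert in \<open>auto simp: c'_def\<close>)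
        then show ?thesis
          using c(2)[of v] insert
          by (simp add: c'_def w'_def algebra_simps sum_subtractf sum_distrib_left)
      qed
      moreover have "\<exists>i\<in>insert x I. c' i \<noteq> 0"
      proof -
        obtain i where "i \<in> I" "c i \<noteq> 0" using c(1) by blast
        moreover have "i \<noteq> x" using \<open>i \<in> I\<close> insert by auto
        ultimately show ?thesis using u by (intro bexI[of _ i]) (auto simp: c'_def)
      qed
      ultimately show ?thesis by blast
    next
      assume "?ind I w'"
      then obtain \<Delta> where \<Delta>: "\<Delta> \<noteq> 0"
        "\<And>p b. mp_eval \<Delta> p \<noteq> 0 \<Longrightarrow> (\<And>v. (\<Sum>i\<in>I. b i * mp_eval (w' i v) p) = 0) \<Longrightarrow> \<forall>i\<in>I. b i = 0"
        by blast
      \<comment> \<open>Including the pivot as a factor next to \<open>\<Delta>\<close> ensures that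
        at every admissible \<open>p\<close> the coefficient of the row \<open>x\<close> is
        recovered from the coordinate \<open>u\<close>.\<close>
      have "\<forall>i\<in>insert x I. b i = 0"
        if p: "mp_eval (\<Delta> * w x u) p \<noteq> 0"
          and b: "\<And>v. (\<Sum>i\<in>insert x I. b i * mp_eval (w i v) p) = 0" for p b
      proof -
        have rel: "(\<Sum>i\<in>I. b i * mp_eval (w i v) p) = - b x * mp_eval (w x v) p" for v
          using b[of v] insert by (simp add: eq_neg_iff_add_eq_0 add.commute)
        have "(\<Sum>i\<in>I. b i * mp_eval (w' i v) p) =
            mp_eval (w x u) p * (\<Sum>i\<in>I. b i * mp_eval (w i v) p)
            - mp_eval (w x v) p * (\<Sum>i\<in>I. b i * mp_eval (w i u) p)" for v
          by (simp add: w'_def mp_eval_diff mp_eval_mult sum_distrib_left sum_subtractf algebra_simps)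
        then have "(\<Sum>i\<in>I. b i * mp_eval (w' i v) p) = 0" for v
          by (simp add: rel algebra_simps)
        then have bI: "\<forall>i\<in>I. b i = 0"
          using \<Delta>(2)[of p b] p by (simp add: mp_eval_mult)
        then have "b x * mp_eval (w x u) p = 0"
          using rel[of u] by simp
        then show ?thesis using bI p by (simp add: mp_eval_mult)
      qed
      then have "?ind (insert x I) w"
        using \<Delta>(1) u by (intro exI[of _ "\<Delta> * w x u"]) auto
      then show ?thesis ..
    qed
  qed
qed

section \<open>Sums of products of linear forms\<close>

lemma lookup_map: "f 0 = 0 \<Longrightarrow> lookup (Poly_Mapping.map f F) m = f (lookup F m)"
  by (auto simp: map.rep_eq when_def)

lemma map_pm_add:
  assumes "f 0 = 0" "\<And>x y. f (x + y) = f x + f y"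
  shows "Poly_Mapping.map f (F + G) = Poly_Mapping.map f F + Poly_Mapping.map f G"
  by (rule poly_mapping_eqI) (simp add: lookup_map lookup_add assms)

lemma map_pm_single:
  assumes "f 0 = 0"
  shows "Poly_Mapping.map f (Poly_Mapping.single m c) = Poly_Mapping.single m (f c)"
  by (rule poly_mapping_eqI) (simp add: lookup_map lookup_single when_def assms)

lemma map_pm_mult:
  fixes f :: "'r::comm_semiring_0 \<Rightarrow> 'r'::comm_semiring_0"
  assumes f: "f 0 = 0" "\<And>x y. f (x + y) = f x + f y" and mult: "\<And>x y. f (x * y) = f x * f y"
  shows "Poly_Mapping.map f (F * G) = Poly_Mapping.map f F * Poly_Mapping.map f (G :: 'm::comm_monoid_add \<Rightarrow>\<^sub>0 'r)"
proof -
  have zero: "Poly_Mapping.map f 0 = (0 :: 'm \<Rightarrow>\<^sub>0 'r')"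
    by (rule poly_mapping_eqI) (simp add: lookup_map f)
  show ?thesis
  proof (induction F rule: poly_mapping_add_induct)
    case (single m a)
    show ?case
      by (induction G rule: poly_mapping_add_induct)
        (simp_all add: zero map_pm_add[of f, OF f] map_pm_single[of f, OF f(1)] mult_single mult
          distrib_left)
  qed (simp_all add: zero distrib_right map_pm_add[of f, OF f])
qed

text \<open>This allows the product rule to be applied to a whole product of linear factors before
  single coefficients are extracted.\<close>

lemma derivation_map_pm:
  fixes D :: "'r::comm_ring_1 \<Rightarrow> 'r"
  assumes D: "derivation D"
  shows "derivation (Poly_Mapping.map D :: ('m::comm_monoid_add \<Rightarrow>\<^sub>0 'r) \<Rightarrow> _)"
proof -
  note [simp] = derivation_0[OF D]
  have add: "Poly_Mapping.map D (F + G) = Poly_Mapping.map D F + Poly_Mapping.map D G"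
    for F G :: "'m \<Rightarrow>\<^sub>0 'r"
    by (rule map_pm_add) (simp_all add: derivation_add[OF D])
  have zero: "Poly_Mapping.map D 0 = (0 :: 'm \<Rightarrow>\<^sub>0 'r)"
    by (rule poly_mapping_eqI) (simp add: lookup_map)
  have "Poly_Mapping.map D (F * G) = Poly_Mapping.map D F * G + F * Poly_Mapping.map D G"
    for F G :: "'m \<Rightarrow>\<^sub>0 'r"
  proof (induction F rule: poly_mapping_add_induct)
    case (single m a)
    show ?case
    proof (induction G rule: poly_mapping_add_induct)
      case (single m' b)
      show ?case
        by (simp add: map_pm_single mult_single derivation_mult[OF D] flip: single_add)
    qed (simp_all add: zero add distrib_left algebra_simps)
  qed (simp_all add: zero add distrib_right algebra_simps)
  then show ?thesis by (simp add: derivation_def add)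
qed

lemma lookup_const_mult: "lookup (Poly_Mapping.single 0 c * F) v = c * lookup F v"
  for F :: "'m::comm_monoid_add \<Rightarrow>\<^sub>0 'r::comm_semiring_0"
  by (induction F rule: poly_mapping_add_induct)
    (simp_all add: distrib_left lookup_add mult_single lookup_single when_def)

section \<open>Sums of products and their partial derivatives\<close>

type_synonym idx = "nat \<times> nat \<times> nat"

text \<open>The index \<open>(t, i, k)\<close> refers to the coefficient of \<open>x\<^sub>k\<close> in the \<open>i\<close>th linear factor of the
  \<open>t\<close>th product; \<open>partial_product n d b (t, i, k)\<close> is the derivative of \<open>sum_of_products n d s b\<close>
  with respect to that coefficient.\<close>

definition linear_factor :: "nat \<Rightarrow> (idx \<Rightarrow> 'r) \<Rightarrow> nat \<Rightarrow> nat \<Rightarrow> (nat, 'r::comm_ring_1) mpoly" where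
  "linear_factor n b t i = (\<Sum>k\<le>n. Poly_Mapping.single (Poly_Mapping.single k 1) (b (t, i, k)))"

text \<open>The coefficient ring stays general: it is the ground field at a point and the polynomial
  ring of the parameters for the generic sum.\<close>

definition sum_of_products :: "nat \<Rightarrow> nat \<Rightarrow> nat \<Rightarrow> (idx \<Rightarrow> 'r) \<Rightarrow> (nat, 'r::comm_ring_1) mpoly" where
  "sum_of_products n d s b = (\<Sum>t<s. \<Prod>i<d. linear_factor n b t i)"

definition partial_product :: "nat \<Rightarrow> nat \<Rightarrow> (idx \<Rightarrow> 'r) \<Rightarrow> idx \<Rightarrow> (nat, 'r::comm_ring_1) mpoly" where
  "partial_product n d b = (\<lambda>(t, i, k). Var k * (\<Prod>j\<in>{..<d} - {i}. linear_factor n b t j))"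

definition all_idx :: "nat \<Rightarrow> nat \<Rightarrow> nat \<Rightarrow> idx set" where
  "all_idx n d s = {..<s} \<times> {..<d} \<times> {..n}"

lemma finite_all_idx: "finite (all_idx n d s)"
  by (simp add: all_idx_def)

context
  fixes a :: "'j \<Rightarrow> 'k::field"
begin

abbreviation "coeff_eval \<equiv> Poly_Mapping.map (\<lambda>f. mp_eval f a)"

lemma coeff_eval_sum: "coeff_eval (\<Sum>i\<in>I. F i) = (\<Sum>i\<in>I. coeff_eval (F i))"
  by (rule poly_mapping_eqI) (simp add: lookup_map lookup_sum mp_eval_sum)

lemma coeff_eval_single: "coeff_eval (Poly_Mapping.single m c) = Poly_Mapping.single m (mp_eval c a)"
  by (rule map_pm_single) simp

lemma coeff_eval_mult: "coeff_eval (F * G) = coeff_eval F * coeff_eval G"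
  for F G :: "'m::comm_monoid_add \<Rightarrow>\<^sub>0 ('j, 'k) mpoly"
  by (rule map_pm_mult) (simp_all add: mp_eval_add mp_eval_mult)

lemma coeff_eval_prod: "coeff_eval (\<Prod>i\<in>I. F i) = (\<Prod>i\<in>I. coeff_eval (F i))"
  for F :: "_ \<Rightarrow> 'm::comm_monoid_add \<Rightarrow>\<^sub>0 ('j, 'k) mpoly"
proof (induction I rule: infinite_finite_induct)
  case (infinite A)
  then show ?case using coeff_eval_single[of "0 :: 'm" 1] by simp
next
  case empty
  then show ?case using coeff_eval_single[of "0 :: 'm" 1] by simp
qed (simp add: coeff_eval_mult)

lemma coeff_eval_linear_factor:
  "coeff_eval (linear_factor n A t i) = linear_factor n (\<lambda>x. mp_eval (A x) a) t i"
  by (simp add: linear_factor_def coeff_eval_sum coeff_eval_single)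

lemma mp_eval_sum_of_products:
  "mp_eval (lookup (sum_of_products n d s A) v) a
    = lookup (sum_of_products n d s (\<lambda>x. mp_eval (A x) a)) v"
proof -
  have "coeff_eval (sum_of_products n d s A) = sum_of_products n d s (\<lambda>x. mp_eval (A x) a)"
    by (simp add: sum_of_products_def coeff_eval_sum coeff_eval_prod coeff_eval_linear_factor)
  then show ?thesis by (metis lookup_map mp_eval_0)
qed

lemma mp_eval_partial_product:
  "mp_eval (lookup (partial_product n d A x) v) a
    = lookup (partial_product n d (\<lambda>x. mp_eval (A x) a) x) v"
proof -
  have "coeff_eval (partial_product n d A x) = partial_product n d (\<lambda>x. mp_eval (A x) a) x"
    by (simp add: partial_product_def split_def coeff_eval_mult coeff_eval_prod
        coeff_eval_linear_factor Var_def coeff_eval_single)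
  then show ?thesis by (metis lookup_map mp_eval_0)
qed

end

text \<open>The chain rule for an arbitrary derivation of the coefficient ring; it is applied both
  to \<open>pd j\<close> and to the vector field found by elimination.\<close>

lemma derivation_sum_of_products:
  fixes D :: "'r::comm_ring_1 \<Rightarrow> 'r"
  assumes D: "derivation D"
  shows "D (lookup (sum_of_products n d s A) v)
    = (\<Sum>x\<in>all_idx n d s. D (A x) * lookup (partial_product n d A x) v)"
proof -
  let ?D = "Poly_Mapping.map D :: (nat, 'r) mpoly \<Rightarrow> _"
  note D' = derivation_map_pm[OF D, where ?'m = "nat \<Rightarrow>\<^sub>0 nat"]
  have lin: "?D (linear_factor n A t i)
      = (\<Sum>k\<le>n. Poly_Mapping.single 0 (D (A (t, i, k))) * Var k)" for t i
    by (simp add: linear_factor_def derivation_sum[OF D'] map_pm_single derivation_0[OF D]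
        Var_def mult_single)
  have "?D (sum_of_products n d s A) = (\<Sum>t<s. \<Sum>i<d. \<Sum>k\<le>n.
      Poly_Mapping.single 0 (D (A (t, i, k))) * partial_product n d A (t, i, k))"
    by (simp add: sum_of_products_def partial_product_def derivation_sum[OF D']
        derivation_prod[OF D'] lin sum_distrib_right mult.assoc)
  moreover have "D (lookup (sum_of_products n d s A) v) = lookup (?D (sum_of_products n d s A)) v"
    by (simp add: lookup_map derivation_0[OF D])
  ultimately show ?thesis
    by (simp add: lookup_sum lookup_const_mult all_idx_def sum.cartesian_product split_def)
qed

lemma forms_prod_set:
  fixes l :: "'i \<Rightarrow> ('v, 'k::comm_semiring_1) mpoly"
  shows "finite I \<Longrightarrow> (\<And>i. i \<in> I \<Longrightarrow> l i \<in> forms V 1) \<Longrightarrow> (\<Prod>i\<in>I. l i) \<in> forms V (card I)"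
proof (induction I rule: finite_induct)
  case (insert x I)
  then show ?case using forms_mult[of "l x" V 1 "\<Prod>i\<in>I. l i" "card I"] by simp
qed (simp add: forms_1)

lemma linear_factor_forms: "linear_factor n b t i \<in> forms {..n} 1"
  unfolding linear_factor_def
  by (intro forms_sum) (auto simp: forms_def monoms_def mdeg_def)

lemma sum_of_products_forms: "sum_of_products n d s b \<in> forms {..n} d"
  unfolding sum_of_products_def
  by (intro forms_sum forms_prod linear_factor_forms)

lemma partial_product_forms: "x \<in> all_idx n d s \<Longrightarrow> partial_product n d b x \<in> forms {..n} d"
proof -
  assume "x \<in> all_idx n d s"
  then obtain t i k where x: "x = (t, i, k)" "i < d" "k \<le> n" by (auto simp: all_idx_def)
  have "Var k * (\<Prod>j\<in>{..<d} - {i}. linear_factor n b t j) \<in> forms {..n} (1 + card ({..<d} - {i}))"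
    by (intro forms_mult Var_in_forms forms_prod_set linear_factor_forms) (use x in auto)
  then show ?thesis using x by (simp add: partial_product_def)
qed

lemma mdeg_eq_0: "mdeg m = 0 \<longleftrightarrow> m = 0"
proof
  assume "mdeg m = 0"
  then have "lookup m v = 0" for v by (auto simp: mdeg_def in_keys_iff)
  then show "m = 0" by (intro poly_mapping_eqI) simp
qed simp

lemma mdeg_eq_1: "mdeg m = 1 \<Longrightarrow> \<exists>j. m = Poly_Mapping.single j 1"
proof -
  assume "mdeg m = 1"
  then obtain j where j: "lookup m j = 1" "\<forall>i\<in>keys m. j \<noteq> i \<longrightarrow> lookup m i = 0"
    unfolding mdeg_def by (subst (asm) sum_eq_1_iff) auto
  have "m = Poly_Mapping.single j 1"
    by (rule poly_mapping_eqI) (use j in \<open>force simp: lookup_single when_def in_keys_iff\<close>)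
  then show ?thesis ..
qed

lemma finite_monoms: "finite V \<Longrightarrow> finite (monoms V d)"
proof -
  assume V: "finite V"
  have "lookup m v \<le> mdeg m" for m and v :: 'a
  proof (cases "v \<in> keys m")
    case True
    then show ?thesis unfolding mdeg_def by (intro member_le_sum) auto
  qed (simp add: in_keys_iff)
  then have "monoms V d \<subseteq> expos V d"
    by (auto simp: monoms_def expos_def)
  then show ?thesis using finite_card_expos(1)[OF V] finite_subset by blast
qed

lemma leads_0I: "lookup f 0 = 1 \<Longrightarrow> leads f 0"
  unfolding leads_def ord_ge_def
proof (intro CollectI ballI)
  fix m assume f: "lookup f 0 = 1" and m: "m \<in> keys (f - Poly_Mapping.single 0 1)"
  have "m \<noteq> 0" using f m by (auto simp: in_keys_iff lookup_minus)
  then have "mdeg m \<noteq> 0" by (simp add: mdeg_eq_0)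
  then show "Suc (mdeg 0) \<le> mdeg m" by simp
qed

lemma leads_singleI:
  assumes "lookup f 0 = 0" "\<And>i. lookup f (Poly_Mapping.single i 1) = (if i = j then 1 else 0)"
  shows "leads f (Poly_Mapping.single j 1)"
  unfolding leads_def ord_ge_def
proof (intro CollectI ballI)
  fix m assume m: "m \<in> keys (f - Poly_Mapping.single (Poly_Mapping.single j 1) 1)"
  have inj: "Poly_Mapping.single j (1::nat) = Poly_Mapping.single i 1 \<longleftrightarrow> j = i" for i
    by (metis lookup_single_eq lookup_single_not_eq zero_neq_one)
  have 0: "Poly_Mapping.single j (1::nat) \<noteq> 0"
    by (metis lookup_single_eq lookup_zero zero_neq_one)
  have "mdeg m \<noteq> 0"
    using m 0 assms(1) by (auto simp: mdeg_eq_0 in_keys_iff lookup_minus lookup_single when_def)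
  moreover have "mdeg m \<noteq> 1"
  proof
    assume "mdeg m = 1"
    then obtain i where i: "m = Poly_Mapping.single i 1" using mdeg_eq_1 by blast
    have "lookup f m - lookup (Poly_Mapping.single (Poly_Mapping.single j 1) 1) m \<noteq> 0"
      using m by (simp only: in_keys_iff lookup_minus not_False_eq_True)
    then show False
      unfolding i assms(2) using inj[of i] by (auto simp: lookup_single when_def)
  qed
  moreover have "mdeg (Poly_Mapping.single j (1::nat)) = 1"
    by (simp add: mdeg_def)
  ultimately show "Suc (mdeg (Poly_Mapping.single j 1)) \<le> mdeg m" by linarith
qed

section \<open>Parametrizations around a point\<close>

text \<open>The coefficients outside \<open>J\<close> are frozen at their values under \<open>p\<close>; those in \<open>J\<close> range
  over translates of \<open>p\<close>, and \<open>to_nat x\<close> is the variable that moves coefficient \<open>x\<close>.\<close>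

definition generic_coeffs :: "idx set \<Rightarrow> (idx \<Rightarrow> 'k) \<Rightarrow> idx \<Rightarrow> (nat, 'k::field) mpoly" where
  "generic_coeffs J p x = Poly_Mapping.single 0 (p x) + (if x \<in> J then Var (to_nat x) else 0)"

definition generic_sum ::
    "nat \<Rightarrow> nat \<Rightarrow> nat \<Rightarrow> idx set \<Rightarrow> (idx \<Rightarrow> 'k) \<Rightarrow> (nat \<Rightarrow>\<^sub>0 nat) \<Rightarrow> (nat, 'k::field) mpoly" where
  "generic_sum n d s J p v = lookup (sum_of_products n d s (generic_coeffs J p)) v"

text \<open>Freezing coefficients can destroy closure under scaling; the missing scalar multiples
  are restored by passing to \<open>proj_closure\<close>.\<close>

definition split_cone :: "nat \<Rightarrow> nat \<Rightarrow> nat \<Rightarrow> idx set \<Rightarrow> (idx \<Rightarrow> 'k::field) \<Rightarrow> (nat, 'k) mpoly set" where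
  "split_cone n d s J p = {sum_of_products n d s b | b. \<forall>x. x \<notin> J \<longrightarrow> b x = p x}"

text \<open>Says that the induced map to projective space is defined at \<open>p\<close> and has
  injective differential in the directions \<open>J\<close>; \<open>c0\<close> accounts for the line
  through the point itself.\<close>

definition indep_at :: "nat \<Rightarrow> nat \<Rightarrow> nat \<Rightarrow> idx set \<Rightarrow> (idx \<Rightarrow> 'k::field) \<Rightarrow> bool" where
  "indep_at n d s J p \<longleftrightarrow> (\<forall>c0 c. pm_scale c0 (sum_of_products n d s p)
      + (\<Sum>x\<in>J. pm_scale (c x) (partial_product n d p x)) = 0 \<longrightarrow> c0 = 0 \<and> (\<forall>x\<in>J. c x = 0))"

lemma mp_eval_generic_coeffs:
  "mp_eval (generic_coeffs J p x) a = p x + (if x \<in> J then a (to_nat x) else 0)"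
  by (auto simp: generic_coeffs_def mp_eval_add mp_eval_single mono_eval_def)

lemma pd_generic_coeffs:
  "pd j (generic_coeffs J p x) = (if x \<in> J \<and> j = to_nat x then 1 else 0)"
  by (auto simp: generic_coeffs_def pd_add pd_Var)

lemma mp_eval_generic_sum: "mp_eval (generic_sum n d s J p v) a
    = lookup (sum_of_products n d s (\<lambda>x. p x + (if x \<in> J then a (to_nat x) else 0))) v"
  by (simp add: generic_sum_def mp_eval_sum_of_products mp_eval_generic_coeffs)

lemma parametrizes_generic_sum:
  fixes p :: "idx \<Rightarrow> 'k::field_char_0"
  shows "parametrizes V (generic_sum n d s J p) (split_cone n d s J p)"
  unfolding parametrizes_def
proof (intro allI ballI)
  fix e G
  have eval: "mp_eval (subst G (generic_sum n d s J p)) a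
      = mp_eval G (lookup (sum_of_products n d s (\<lambda>x. p x + (if x \<in> J then a (to_nat x) else 0))))"
    for a by (simp add: mp_eval_subst mp_eval_generic_sum[abs_def])
  show "vanish (split_cone n d s J p) G \<longleftrightarrow> subst G (generic_sum n d s J p) = 0"
  proof
    assume v: "vanish (split_cone n d s J p) G"
    show "subst G (generic_sum n d s J p) = 0"
    proof (rule mp_eval_eq_0_imp_0)
      fix a
      show "mp_eval (subst G (generic_sum n d s J p)) a = 0"
      proof -
        have "sum_of_products n d s (\<lambda>x. p x + (if x \<in> J then a (to_nat x) else 0)) \<in> split_cone n d s J p"
          unfolding split_cone_def by (rule CollectI, rule exI, rule conjI[OF refl]) simp
        then show ?thesis unfolding eval using v by (simp add: vanish_def)
      qed
    qed
  next
    assume z: "subst G (generic_sum n d s J p) = 0"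
    show "vanish (split_cone n d s J p) G"
      unfolding vanish_def
    proof
      fix f assume "f \<in> split_cone n d s J p"
      then obtain b where b: "f = sum_of_products n d s b" "\<And>x. x \<notin> J \<Longrightarrow> b x = p x"
        by (auto simp: split_cone_def)
      \<comment> \<open>\<open>from_nat\<close> undoes \<open>to_nat\<close>, so the displacement
        \<open>b - p\<close> reaches every admissible \<open>b\<close>.\<close>
      have "(\<lambda>x. p x + (if x \<in> J then b (from_nat (to_nat x)) - p (from_nat (to_nat x)) else 0)) = b"
        using b(2) by (auto simp: fun_eq_iff)
      then show "mp_eval G (lookup f) = 0"
        using eval[of "\<lambda>j. b (from_nat j) - p (from_nat j)"] z by (simp add: b(1))
    qed
  qed
qed

lemma poly_box_coeffs_mult:
  fixes F G :: "'m::comm_monoid_add \<Rightarrow>\<^sub>0 ('j, 'k::comm_semiring_1) mpoly"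
  assumes "\<And>v. lookup F v \<in> poly_box J B" "\<And>v. lookup G v \<in> poly_box J B'"
  shows "lookup (F * G) v \<in> poly_box J (B + B')"
proof -
  have "F * G = (\<Sum>m\<in>keys F. Poly_Mapping.single m (lookup F m)) * (\<Sum>m\<in>keys G. Poly_Mapping.single m (lookup G m))"
    using poly_mapping_sum_single[of F] poly_mapping_sum_single[of G] by simp
  then have "lookup (F * G) v =
      (\<Sum>m\<in>keys F. \<Sum>m'\<in>keys G. lookup (Poly_Mapping.single (m + m') (lookup F m * lookup G m')) v)"
    by (simp only: sum_product mult_single lookup_sum)
  also have "\<dots> \<in> poly_box J (B + B')"
    by (intro box_sum) (simp add: lookup_single when_def box_mult assms)
  finally show ?thesis .
qed

lemma generic_sum_box: "generic_sum n d s J p v \<in> poly_box (to_nat ` J) d"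
proof -
  have lin: "lookup (linear_factor n (generic_coeffs J p) t i) v \<in> poly_box (to_nat ` J) 1" for t i v
    unfolding linear_factor_def lookup_sum
    by (intro box_sum)
      (simp add: lookup_single when_def generic_coeffs_def box_add box_const box_Var[simplified])
  have "lookup (\<Prod>i<k. linear_factor n (generic_coeffs J p) t i) v \<in> poly_box (to_nat ` J) k" for t k v
  proof (induction k arbitrary: v)
    case 0
    then show ?case by (auto simp: lookup_one when_def box_1)
  next
    case (Suc k)
    then show ?case
      using poly_box_coeffs_mult[OF Suc lin] by simp
  qed
  then show ?thesis
    unfolding generic_sum_def sum_of_products_def lookup_sum by (intro box_sum)
qed

lemma hilbert_ge_cone_upper:
  fixes p :: "idx \<Rightarrow> 'k::field_char_0"
  assumes "finite J" "hilbert_ge (\<Union>(proj_closure V (split_cone n d s J p))) V e m"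
  shows "m \<le> (d * e + 1) ^ card J"
proof -
  have "m \<le> (d * e + 1) ^ card ((to_nat :: idx \<Rightarrow> nat) ` J)"
  proof (rule hilbert_ge_upper[OF _ _ _ assms(2), where \<phi> = "generic_sum n d s J p"])
    fix G assume "G \<in> forms V e" "subst G (generic_sum n d s J p) = 0"
    then show "vanish (\<Union>(proj_closure V (split_cone n d s J p))) G"
      using parametrizesD[OF parametrizes_generic_sum] proj_closure_vanish by blast
  qed (use assms generic_sum_box in auto)
  then show ?thesis by (simp add: card_image)
qed

lemma hilbert_ge_chain_closure:
  assumes "irreducible_chain (subtopology (zariski V) (proj_closure V C)) m Z"
  shows "\<exists>g. \<forall>L. hilbert_ge (\<Union>(proj_closure V C)) V (g * m * L) (L ^ m)"
proof -
  have "irreducible_closed (subtopology (zariski V) (proj_closure V C)) (Z m)"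
    using assms by (simp add: irreducible_chain_def)
  then have "closedin (subtopology (zariski V) (proj_closure V C)) (Z m)"
    by (simp add: irreducible_closed_def)
  then have "Z m \<subseteq> proj_closure V C"
    using closedin_subset by (fastforce simp: topspace_subtopology)
  then show ?thesis
    using hilbert_ge_chain[OF closedin_proj_closure assms] hilbert_ge_mono Union_mono by metis
qed

lemma chain_length_le:
  fixes p :: "idx \<Rightarrow> 'k::field_char_0"
  assumes "finite J"
    and "irreducible_chain (subtopology (zariski V) (proj_closure V (split_cone n d s J p))) m Z"
  shows "m \<le> card J"
proof -
  obtain g where g: "\<And>L. hilbert_ge (\<Union>(proj_closure V (split_cone n d s J p))) V (g * m * L) (L ^ m)"
    using hilbert_ge_chain_closure[OF assms(2)] by blast
  show ?thesis
  proof (rule power_growth)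
    fix L
    show "L ^ m \<le> (d * g * m * L + 1) ^ card J"
      using hilbert_ge_cone_upper[OF assms(1) g[of L]] by (simp add: mult.assoc)
  qed
qed

lemma lookup_subst_linear_form:
  fixes \<phi> :: "'v \<Rightarrow> ('j, 'k::field_char_0) mpoly"
  shows "lookup (subst (\<Sum>v\<in>V. pm_scale (y v) (Var v)) \<phi>) m = (\<Sum>v\<in>V. y v * lookup (\<phi> v) m)"
  by (simp add: subst_lincomb subst_Var lookup_sum)

text \<open>The parameters are displacements from \<open>p\<close>, so constant and linear
  coefficients are the value and the partial derivatives at \<open>p\<close>.\<close>

lemma lookup_generic_sum_0: "lookup (generic_sum n d s J p v) 0 = lookup (sum_of_products n d s p) v"
proof -
  have "lookup (generic_sum n d s J p v) 0 = mp_eval (generic_sum n d s J p v) (\<lambda>_. 0)"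
    by (simp add: mp_eval_zero)
  then show ?thesis by (simp add: mp_eval_generic_sum cong: if_cong)
qed

lemma lookup_generic_sum_1:
  assumes "J \<subseteq> all_idx n d s"
  shows "lookup (generic_sum n d s J p v) (Poly_Mapping.single j 1)
    = (\<Sum>x\<in>J. if j = to_nat x then lookup (partial_product n d p x) v else 0)"
proof -
  have 0: "lookup (lookup (partial_product n d (generic_coeffs J p) x) v) 0
      = lookup (partial_product n d p x) v" for x
  proof -
    have "lookup (lookup (partial_product n d (generic_coeffs J p) x) v) 0
        = mp_eval (lookup (partial_product n d (generic_coeffs J p) x) v) (\<lambda>_. 0)"
      by (simp add: mp_eval_zero)
    then show ?thesis by (simp add: mp_eval_partial_product mp_eval_generic_coeffs cong: if_cong)
  qed
  have "lookup (generic_sum n d s J p v) (Poly_Mapping.single j 1)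
      = lookup (pd j (generic_sum n d s J p v)) 0"
    by (simp add: lookup_pd_0)
  also have "\<dots> = (\<Sum>x\<in>all_idx n d s. if x \<in> J \<and> j = to_nat x
      then lookup (partial_product n d p x) v else 0)"
    unfolding generic_sum_def derivation_sum_of_products[OF derivation_pd] lookup_sum
    by (rule sum.cong) (simp_all add: pd_generic_coeffs 0)
  also have "\<dots> = (\<Sum>x\<in>J. if x \<in> J \<and> j = to_nat x then lookup (partial_product n d p x) v else 0)"
    by (rule sum.mono_neutral_right) (use assms finite_all_idx in auto)
  also have "\<dots> = (\<Sum>x\<in>J. if j = to_nat x then lookup (partial_product n d p x) v else 0)"
    by (rule sum.cong) auto
  finally show ?thesis .
qed

text \<open>Independent vectors have dual functionals, which are linear forms on the ambient space.
  The one dual to the sum (index \<open>None\<close>) pulls back to 1 plus higher terms, the one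
  dual to the derivative at \<open>x\<close> to the parameter of \<open>x\<close> plus higher
  terms.\<close>

lemma hilbert_ge_cone_lower:
  fixes p :: "idx \<Rightarrow> 'k::field_char_0"
  assumes ind: "indep_at n d s J p" and J: "J \<subseteq> all_idx n d s"
  shows "hilbert_ge (split_cone n d s J p) (monoms {..n} d) (card J * L) (L ^ card J)"
proof -
  let ?V = "monoms {..n} d"
  have fJ: "finite J" using J finite_all_idx finite_subset by blast
  define w where "w i = (case i of None \<Rightarrow> sum_of_products n d s p | Some x \<Rightarrow> partial_product n d p x)" for i
  define I where "I = insert None (Some ` J)"
  obtain y where y: "\<And>i j. i \<in> I \<Longrightarrow> j \<in> I \<Longrightarrow>
      (\<Sum>v\<in>?V. y i v * lookup (w j) v) = (if i = j then 1 else 0)"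
  proof (rule dual_coordinates)
    show "finite I" "finite ?V"
      using fJ by (auto simp: I_def finite_monoms)
    show "keys (w i) \<subseteq> ?V" if "i \<in> I" for i
      using that sum_of_products_forms[of n d s p] subsetD[OF J, THEN partial_product_forms, of _ p]
      by (auto simp: I_def w_def forms_def subset_iff)
    fix c assume "(\<Sum>i\<in>I. pm_scale (c i) (w i)) = 0"
    then have "pm_scale (c None) (sum_of_products n d s p)
        + (\<Sum>x\<in>J. pm_scale (c (Some x)) (partial_product n d p x)) = 0"
      using fJ by (simp add: I_def w_def sum.reindex)
    then have "c None = 0 \<and> (\<forall>x\<in>J. c (Some x) = 0)"
      using ind[unfolded indep_at_def, rule_format, of "c None" "\<lambda>x. c (Some x)"] by blast
    then show "\<forall>i\<in>I. c i = 0" by (auto simp: I_def)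
  next
    fix y assume "\<And>i j. i \<in> I \<Longrightarrow> j \<in> I \<Longrightarrow>
      (\<Sum>v\<in>?V. y i v * lookup (w j) v) = (if i = j then 1 else 0)"
    then show thesis by (rule that)
  qed
  define \<Lambda> where "\<Lambda> i = (\<Sum>v\<in>?V. pm_scale (y i v) (Var v))" for i
  have \<Lambda>: "\<Lambda> i \<in> forms ?V 1" for i
    unfolding \<Lambda>_def by (intro forms_sum forms_scale Var_in_forms)
  let ?\<phi> = "generic_sum n d s J p"
  have l0: "lookup (subst (\<Lambda> i) ?\<phi>) 0 = (if i = None then 1 else 0)" if "i \<in> I" for i
    unfolding \<Lambda>_def lookup_subst_linear_form lookup_generic_sum_0
    using y[OF that, of None] by (simp add: w_def I_def)
  have l1: "lookup (subst (\<Lambda> i) ?\<phi>) (Poly_Mapping.single j 1)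
      = (\<Sum>x\<in>J. if j = to_nat x then if i = Some x then 1 else 0 else 0)" if i: "i \<in> I" for i j
  proof -
    have "lookup (subst (\<Lambda> i) ?\<phi>) (Poly_Mapping.single j 1)
        = (\<Sum>v\<in>?V. \<Sum>x\<in>J. y i v * (if j = to_nat x then lookup (partial_product n d p x) v else 0))"
      unfolding \<Lambda>_def lookup_subst_linear_form lookup_generic_sum_1[OF J] sum_distrib_left ..
    also have "\<dots> = (\<Sum>x\<in>J. \<Sum>v\<in>?V. y i v * (if j = to_nat x then lookup (partial_product n d p x) v else 0))"
      by (rule sum.swap)
    also have "\<dots> = (\<Sum>x\<in>J. if j = to_nat x then if i = Some x then 1 else 0 else 0)"
      using y[OF i, of "Some _"] by (intro sum.cong) (auto simp: w_def I_def)
    finally show ?thesis .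
  qed
  show ?thesis
  proof (rule hilbert_ge_lower[OF parametrizes_generic_sum fJ, where h = to_nat
        and M = "\<Lambda> None" and \<Lambda> = "\<lambda>x. \<Lambda> (Some x)"])
    show "leads (subst (\<Lambda> None) ?\<phi>) 0"
      by (rule leads_0I) (use l0[of None] in \<open>simp add: I_def\<close>)
    fix x assume x: "x \<in> J"
    then have xI: "Some x \<in> I" by (simp add: I_def)
    show "leads (subst (\<Lambda> (Some x)) ?\<phi>) (Poly_Mapping.single (to_nat x) 1)"
    proof (rule leads_singleI)
      show "lookup (subst (\<Lambda> (Some x)) ?\<phi>) 0 = 0"
        using l0[OF xI] by simp
      fix j
      have "(\<Sum>x'\<in>J. if j = to_nat x' then if Some x = Some x' then 1 else 0 else (0::'k))
          = (\<Sum>x'\<in>J. if x' = x then if j = to_nat x then 1 else 0 else 0)"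
        by (rule sum.cong) auto
      also have "\<dots> = (if j = to_nat x then 1 else 0)"
        using x fJ by simp
      finally show "lookup (subst (\<Lambda> (Some x)) ?\<phi>) (Poly_Mapping.single j 1)
          = (if j = to_nat x then 1 else 0)"
        unfolding l1[OF xI] .
    qed
  qed (rule inj_to_nat[THEN inj_on_subset], simp, (rule \<Lambda>)+)
qed

lemma indep_at_subset:
  assumes "indep_at n d s J p" "J' \<subseteq> J" "finite J"
  shows "indep_at n d s J' p"
  unfolding indep_at_def
proof (intro allI impI)
  fix c0 c assume rel: "pm_scale c0 (sum_of_products n d s p)
      + (\<Sum>x\<in>J'. pm_scale (c x) (partial_product n d p x)) = 0"
  have "(\<Sum>x\<in>J. pm_scale (if x \<in> J' then c x else 0) (partial_product n d p x))
      = (\<Sum>x\<in>J'. pm_scale (if x \<in> J' then c x else 0) (partial_product n d p x))"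
    by (rule sum.mono_neutral_right) (use assms in auto)
  also have "\<dots> = (\<Sum>x\<in>J'. pm_scale (c x) (partial_product n d p x))"
    by (rule sum.cong) auto
  finally have "c0 = 0 \<and> (\<forall>x\<in>J. (if x \<in> J' then c x else 0) = 0)"
    using assms(1)[unfolded indep_at_def, rule_format, of c0 "\<lambda>x. if x \<in> J' then c x else 0"] rel
    by simp
  then show "c0 = 0 \<and> (\<forall>x\<in>J'. c x = 0)"
    using assms(2) by (metis subsetD)
qed

lemma cone_mono: "J \<subseteq> J' \<Longrightarrow> split_cone n d s J p \<subseteq> split_cone n d s J' p"
  unfolding split_cone_def by blast

lemma keys_cone: "f \<in> split_cone n d s J p \<Longrightarrow> keys f \<subseteq> monoms {..n} d"
  using sum_of_products_forms[of n d s] by (auto simp: split_cone_def forms_def)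

lemma proj_closure_mono: "C \<subseteq> C' \<Longrightarrow> proj_closure V C \<subseteq> proj_closure V C'"
  by (auto simp: proj_closure_def dest: vanish_mono)

text \<open>The coefficients in \<open>J\<close> are released one at a time; independence of the derivatives at
  \<open>p\<close> makes the Hilbert function of the closure grow at each step.\<close>

lemma irreducible_chain_of_indep_at:
  fixes p :: "idx \<Rightarrow> 'k::field_char_0"
  assumes ind: "indep_at n d s J p" and J: "J \<subseteq> all_idx n d s"
  shows "\<exists>Z. irreducible_chain
    (subtopology (zariski (monoms {..n} d)) (proj_closure (monoms {..n} d) (split_cone n d s J p))) (card J) Z"
proof -
  let ?V = "monoms {..n} d"
  have fJ: "finite J" using J finite_all_idx finite_subset by blast
  obtain h where h: "bij_betw h {..<card J} J"
    using ex_bij_betw_nat_finite[OF fJ] by (auto simp: atLeast0LessThan)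
  define K where "K k = h ` {..<k}" for k
  have K: "K k \<subseteq> J" "card (K k) = k" "finite (K k)" if "k \<le> card J" for k
  proof -
    have inj: "inj_on h {..<k}"
      using h that by (auto simp: bij_betw_def intro: inj_on_subset)
    then show "card (K k) = k" by (simp add: K_def card_image)
    show "K k \<subseteq> J" using h that by (auto simp: K_def bij_betw_def)
    show "finite (K k)" by (simp add: K_def)
  qed
  have KJ: "K (card J) = J" using h by (simp add: K_def bij_betw_def)
  define Z where "Z k = proj_closure ?V (split_cone n d s (K k) p)" for k
  have mono: "Z k \<subseteq> Z k'" if "k \<le> k'" for k k'
    unfolding Z_def by (intro proj_closure_mono cone_mono) (use that in \<open>auto simp: K_def\<close>)
  have p0: "sum_of_products n d s p \<noteq> 0"
  proof
    assume "sum_of_products n d s p = 0"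
    then show False
      using ind[unfolded indep_at_def, rule_format, of 1 "\<lambda>_. 0"] by simp
  qed
  have p_in: "sum_of_products n d s p \<in> split_cone n d s J' p" for J'
    by (auto simp: split_cone_def)
  have in_cl: "split_cone n d s J' p \<subseteq> \<Union>(proj_closure ?V (split_cone n d s J' p))" for J'
    using subset_Union_proj_closure[OF keys_cone p_in p0] .
  have "irreducible_closed (subtopology (zariski ?V) (Z (card J))) (Z k)" if "k \<le> card J" for k
    unfolding Z_def
  proof (rule prime_cone_imp_irreducible_closed[OF closedin_proj_closure])
    show "proj_closure ?V (split_cone n d s (K k) p) \<subseteq> proj_closure ?V (split_cone n d s (K (card J)) p)"
      using mono[OF that] by (simp add: Z_def)
    show "proj_closure ?V (split_cone n d s (K k) p) \<noteq> {}"
      using in_cl[of "K k"] p_in[of "K k"] by blast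
  qed (use in_cl parametrizes_prime_cone[OF parametrizes_generic_sum] in auto)
  moreover have "Z k \<subset> Z (Suc k)" if k: "k < card J" for k
  proof -
    have "Z k \<noteq> Z (Suc k)"
    proof
      assume eq: "Z k = Z (Suc k)"
      \<comment> \<open>Were the closures equal, growth of order \<open>k + 1\<close> from
        independence at \<open>p\<close> would meet the upper bound by the \<open>k\<close>
        parameters in \<open>K k\<close>.\<close>
      have "Suc k \<le> k"
      proof (rule power_growth)
        fix L
        have "hilbert_ge (split_cone n d s (K (Suc k)) p) ?V (Suc k * L) (L ^ Suc k)"
          using hilbert_ge_cone_lower[OF indep_at_subset[OF ind K(1) fJ], of "Suc k" L] K[of "Suc k"] J k
          by (simp add: subset_trans)
        then have "hilbert_ge (\<Union>(Z k)) ?V (Suc k * L) (L ^ Suc k)"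
          by (rule hilbert_ge_mono) (use in_cl[of "K (Suc k)"] eq in \<open>simp add: Z_def\<close>)
        then have "L ^ Suc k \<le> (d * (Suc k * L) + 1) ^ card (K k)"
          unfolding Z_def by (rule hilbert_ge_cone_upper[OF K(3)[OF less_imp_le[OF k]]])
        then show "L ^ Suc k \<le> (d * Suc k * L + 1) ^ k"
          using K(2)[of k] k by (simp only: mult.assoc less_imp_le)
      qed
      then show False by simp
    qed
    then show ?thesis using mono[of k "Suc k"] by auto
  qed
  ultimately have "irreducible_chain (subtopology (zariski ?V) (Z (card J))) (card J) Z"
    by (simp add: irreducible_chain_def)
  then show ?thesis unfolding Z_def KJ by blast
qed

text \<open>If no such point exists, elimination yields a polynomial relation between the generic sum and
  its partial derivatives, that is, a twisted derivation for which all coordinates are eigenvectors.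
  A variable moved by it is then transcendental over the coordinates, which are thus too few.\<close>

lemma indep_at_of_chain:
  fixes p :: "idx \<Rightarrow> 'k::field_char_0"
  assumes J: "J \<subseteq> all_idx n d s" "J \<noteq> {}"
    and chain: "irreducible_chain (subtopology (zariski V) (proj_closure V (split_cone n d s J p))) m Z"
    and m: "card J \<le> m"
  shows "\<exists>b. (\<forall>x. x \<notin> J \<longrightarrow> b x = p x) \<and> indep_at n d s J b"
proof -
  have fJ: "finite J" using J finite_all_idx finite_subset by blast
  let ?A = "generic_coeffs J p" and ?\<phi> = "generic_sum n d s J p"
  let ?C = "\<Union>(proj_closure V (split_cone n d s J p))"
  define w where "w i v = (case i of None \<Rightarrow> ?\<phi> v | Some x \<Rightarrow> lookup (partial_product n d ?A x) v)" for i v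
  define I where "I = insert None (Some ` J)"
  have sum_I: "(\<Sum>i\<in>I. c i * f i) = c None * f None + (\<Sum>x\<in>J. c (Some x) * f (Some x))"
    for c f :: "idx option \<Rightarrow> 'r::comm_ring_1"
    using fJ by (simp add: I_def sum.reindex)
  have "finite I" using fJ by (simp add: I_def)
  from polynomial_relation_or_generic_independence[OF this, of w] show ?thesis
  proof
    assume "\<exists>\<Delta>. \<Delta> \<noteq> 0 \<and> (\<forall>p. mp_eval \<Delta> p \<noteq> 0 \<longrightarrow>
      (\<forall>b. (\<forall>v. (\<Sum>i\<in>I. b i * mp_eval (w i v) p) = 0) \<longrightarrow> (\<forall>i\<in>I. b i = 0)))"
    then obtain \<Delta> where \<Delta>: "\<Delta> \<noteq> 0" "\<And>a c. mp_eval \<Delta> a \<noteq> 0 \<Longrightarrow>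
      (\<And>v. (\<Sum>i\<in>I. c i * mp_eval (w i v) a) = 0) \<Longrightarrow> \<forall>i\<in>I. c i = 0" by blast
    obtain a where a: "mp_eval \<Delta> a \<noteq> 0"
      using \<Delta>(1) mp_eval_eq_0_imp_0 by blast
    define b where "b x = p x + (if x \<in> J then a (to_nat x) else 0)" for x
    have w_a: "mp_eval (w None v) a = lookup (sum_of_products n d s b) v"
      "mp_eval (w (Some x) v) a = lookup (partial_product n d b x) v" for x v
      by (simp_all add: w_def mp_eval_generic_sum mp_eval_partial_product mp_eval_generic_coeffs b_def[abs_def])
    have "indep_at n d s J b"
      unfolding indep_at_def
    proof (intro allI impI)
      fix c0 c assume rel: "pm_scale c0 (sum_of_products n d s b)
        + (\<Sum>x\<in>J. pm_scale (c x) (partial_product n d b x)) = 0"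
      define c' where "c' i = (case i of None \<Rightarrow> c0 | Some x \<Rightarrow> c x)" for i
      have "(\<Sum>i\<in>I. c' i * mp_eval (w i v) a) = 0" for v
        using arg_cong[OF rel, of "\<lambda>F. lookup F v"]
        by (simp add: sum_I w_a c'_def lookup_add lookup_sum)
      then have "\<forall>i\<in>I. c' i = 0" using \<Delta>(2)[OF a] by blast
      then show "c0 = 0 \<and> (\<forall>x\<in>J. c x = 0)" by (auto simp: I_def c'_def)
    qed
    then show ?thesis by (intro exI[of _ b]) (simp add: b_def)
  next
    assume "\<exists>c. (\<exists>i\<in>I. c i \<noteq> 0) \<and> (\<forall>v. (\<Sum>i\<in>I. c i * w i v) = 0)"
    then obtain c where c: "\<exists>i\<in>I. c i \<noteq> 0" "\<And>v. (\<Sum>i\<in>I. c i * w i v) = 0" by blast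
    obtain g where g: "\<And>L. hilbert_ge ?C V (g * m * L) (L ^ m)"
      using hilbert_ge_chain_closure[OF chain] by blast
    have van: "vanish ?C G" if "G \<in> forms V e" "subst G ?\<phi> = 0" for G e
      using that parametrizesD[OF parametrizes_generic_sum] proj_closure_vanish by blast
    have "card J > 0" using fJ J by (simp add: card_gt_0_iff)
    define D where "D f = (\<Sum>x\<in>J. c (Some x) * pd (to_nat x) f)" for f
    have D: "derivation D"
      by (auto simp: derivation_def D_def pd_add pd_mult algebra_simps sum.distrib sum_distrib_left)
    have const: "D (Poly_Mapping.single 0 c) = 0" for c
      by (simp add: D_def)
    have D_Var: "D (Var (to_nat x)) = (if x \<in> J then c (Some x) else 0)" for x
      using fJ by (simp add: D_def pd_Var if_distrib[of "(*) _"] cong: if_cong)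
    have D_A: "D (?A x) = (if x \<in> J then c (Some x) else 0)" for x
      using D_Var[of x] derivation_0[OF D]
      by (simp add: generic_coeffs_def derivation_add[OF D] const)
    have eig: "D (?\<phi> v) = - c None * ?\<phi> v" for v
    proof -
      have "D (?\<phi> v) = (\<Sum>x\<in>all_idx n d s. D (?A x) * lookup (partial_product n d ?A x) v)"
        by (simp add: generic_sum_def derivation_sum_of_products[OF D])
      also have "\<dots> = (\<Sum>x\<in>J. D (?A x) * lookup (partial_product n d ?A x) v)"
        by (rule sum.mono_neutral_right) (use J finite_all_idx D_A in auto)
      also have "\<dots> = (\<Sum>x\<in>J. c (Some x) * w (Some x) v)"
        by (rule sum.cong) (auto simp: D_A w_def)
      also have "\<dots> = - (c None * w None v)"
        using c(2)[of v] by (simp add: sum_I eq_neg_iff_add_eq_0 add.commute)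
      finally show ?thesis by (simp add: w_def)
    qed
    have False
    proof (cases "\<exists>x\<in>J. c (Some x) \<noteq> 0")
      case True
      then obtain x where x: "x \<in> J" "c (Some x) \<noteq> 0" by blast
      \<comment> \<open>The powers of the moved variable contribute the additional factor
        \<open>L\<close>.\<close>
      have "Suc m \<le> card J"
      proof (rule power_growth)
        fix L
        have "L * L ^ m \<le> (d * (g * m * L) + L + 1) ^ card ((to_nat :: idx \<Rightarrow> nat) ` J)"
          by (rule hilbert_ge_upper_derivation[OF _ _ van g[of L] D const eig])
            (use fJ x D_Var[of x] generic_sum_box in auto)
        then show "L ^ Suc m \<le> ((d * g * m + 1) * L + 1) ^ card J"
          by (simp add: card_image algebra_simps)
      qed
      then show False using m by simp
    next
      case False
      then have "D f = 0" for f by (simp add: D_def)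
      moreover have "c None \<noteq> 0" using c(1) False by (auto simp: I_def)
      ultimately have \<phi>0: "?\<phi> v = 0" for v using eig[of v] by simp
      \<comment> \<open>Only the relation \<open>c None * \<phi> v = 0\<close> is left, so all
        coordinates vanish identically; a parametrization by no parameters at all then bounds the
        chain.\<close>
      have "m \<le> 0"
      proof (rule power_growth)
        fix L
        have "L ^ m \<le> (0 * (g * m * L) + 1) ^ card ({} :: nat set)"
          by (rule hilbert_ge_upper[OF _ _ van g[of L]]) (simp_all add: \<phi>0)
        then show "L ^ m \<le> (0 * L + 1) ^ 0" by simp
      qed
      then show False using m \<open>card J > 0\<close> by simp
    qed
    then show ?thesis ..
  qed
qed

section \<open>Secant varieties of the Chow variety\<close>

lemma Var_neq_0: "Var v \<noteq> (0 :: ('v, 'k::comm_ring_1) mpoly)"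
proof
  assume "Var v = (0 :: ('v, 'k) mpoly)"
  then have "mp_eval (Var v) (\<lambda>_. 1 :: 'k) = 0" by simp
  then show False by simp
qed

lemma prod_pm_scale: "(\<Prod>i\<in>I. pm_scale (c i) (f i)) = pm_scale (\<Prod>i\<in>I. c i) (\<Prod>i\<in>I. f i)"
  for f :: "'i \<Rightarrow> ('v, 'k::field) mpoly"
  by (induction I rule: infinite_finite_induct)
    (simp_all add: pm_scale_mult_left pm_scale_mult_right mult.commute)

lemma linear_factor_scale:
  assumes "\<And>k. k \<le> n \<Longrightarrow> b' (t, i, k) = c * b (t, i, k)"
  shows "linear_factor n b' t i = pm_scale c (linear_factor n b t i)"
  unfolding linear_factor_def pm.scale_sum_right
proof (rule sum.cong)
  fix k assume "k \<in> {..n}"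
  then show "Poly_Mapping.single (Poly_Mapping.single k 1) (b' (t, i, k))
      = pm_scale c (Poly_Mapping.single (Poly_Mapping.single k 1) (b (t, i, k)))"
    using assms by (intro poly_mapping_eqI) (simp add: lookup_single when_def)
qed simp

section \<open>The normalized parametrization of the secant variety\<close>

text \<open>The leading coefficients of all linear factors are normalized to 1, except that those of the
  first factors absorb the scalars; one overall scalar remains.\<close>

definition free_idx :: "nat \<Rightarrow> nat \<Rightarrow> nat \<Rightarrow> idx set" where
  "free_idx n d s = {..<s} \<times> {..<d} \<times> {1..n} \<union> {1..<s} \<times> {0} \<times> {0}"

lemma free_idx_subset: "d > 0 \<Longrightarrow> free_idx n d s \<subseteq> all_idx n d s"
  by (auto simp: free_idx_def all_idx_def)

lemma card_free_idx: "s > 0 \<Longrightarrow> card (free_idx n d s) = s * (d * n + 1) - 1"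
  unfolding free_idx_def by (subst card_Un_disjoint) (auto simp: algebra_simps)

lemma normalize_sum_of_products:
  fixes b :: "idx \<Rightarrow> 'k::field"
  assumes "d > 0" "s > 0" and nz: "\<And>t i. t < s \<Longrightarrow> i < d \<Longrightarrow> b (t, i, 0) \<noteq> 0"
  shows "\<exists>c. \<exists>f\<in>split_cone n d s (free_idx n d s) (\<lambda>_. 1). sum_of_products n d s b = pm_scale c f"
proof -
  define \<beta> where "\<beta> t = (\<Prod>i<d. b (t, i, 0))" for t
  have \<beta>: "\<beta> t \<noteq> 0" if "t < s" for t
    using nz that by (auto simp: \<beta>_def)
  \<comment> \<open>The factors \<open>r t i\<close> of a fixed \<open>t\<close> multiply to
    \<open>1 / \<beta> 0\<close>, which is independent of \<open>t\<close> and thus an overall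
    scalar. The leading coefficient becomes \<open>\<beta> t / \<beta> 0\<close> for
    \<open>i = 0\<close> and 1 otherwise; for \<open>t = 0\<close> it is 1 in both cases.\<close>
  define r where "r t i = (if i = 0 then \<beta> t / \<beta> 0 else 1) / b (t, i, 0)" for t i
  define b' where "b' x = (case x of (t, i, k) \<Rightarrow> if x \<in> all_idx n d s then r t i * b (t, i, k) else 1)" for x
  have "(\<Prod>i<d. linear_factor n b' t i) = pm_scale (1 / \<beta> 0) (\<Prod>i<d. linear_factor n b t i)"
    if t: "t < s" for t
  proof -
    have "(\<Prod>i<d. linear_factor n b' t i) = (\<Prod>i<d. pm_scale (r t i) (linear_factor n b t i))"
      by (intro prod.cong linear_factor_scale) (use t in \<open>auto simp: b'_def all_idx_def\<close>)
    also have "\<dots> = pm_scale (\<Prod>i<d. r t i) (\<Prod>i<d. linear_factor n b t i)"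
      by (rule prod_pm_scale)
    also have "(\<Prod>i<d. r t i) = (\<Prod>i<d. if i = 0 then \<beta> t / \<beta> 0 else 1) / \<beta> t"
      by (simp add: r_def \<beta>_def prod_dividef)
    also have "\<dots> = 1 / \<beta> 0"
      using \<beta>[OF t] \<open>d > 0\<close> by simp
    finally show ?thesis .
  qed
  then have "sum_of_products n d s b' = pm_scale (1 / \<beta> 0) (sum_of_products n d s b)"
    by (simp add: sum_of_products_def pm.scale_sum_right)
  then have "sum_of_products n d s b = pm_scale (\<beta> 0) (sum_of_products n d s b')"
    using \<beta>[OF \<open>s > 0\<close>] by simp
  moreover have "b' x = 1" if not_free: "x \<notin> free_idx n d s" for x
  proof (cases "x \<in> all_idx n d s")
    case True
    obtain t i k where tik: "x = (t, i, k)" by (cases x)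
    have "k = 0"
      using not_free True tik by (cases k) (auto simp: free_idx_def all_idx_def)
    then have x: "x = (t, i, 0)" "t < s" "i < d" "i \<noteq> 0 \<or> t = 0"
      using not_free True tik by (cases t; auto simp: free_idx_def all_idx_def)+
    then show ?thesis
      using nz[OF x(2,3)] \<beta>[OF x(2)] True by (auto simp: b'_def r_def)
  qed (auto simp: b'_def)
  ultimately show ?thesis unfolding split_cone_def by blast
qed

text \<open>Normalization fails when some leading coefficient is zero. The pullback
  \<open>?Q\<close> times the product \<open>?R\<close> of all leading coefficients vanishes at
  every point in either case, and the nonzero polynomial \<open>?R\<close> can be cancelled.\<close>

lemma vanish_split_cone_iff:
  fixes G :: "(nat \<Rightarrow>\<^sub>0 nat, 'k::field_char_0) mpoly"
  assumes "d > 0" "s > 0" and G: "G \<in> forms V e"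
  shows "vanish (split_cone n d s (free_idx n d s) (\<lambda>_. 1)) G
    \<longleftrightarrow> (\<forall>b. mp_eval G (lookup (sum_of_products n d s b)) = 0)"
proof
  assume v: "vanish (split_cone n d s (free_idx n d s) (\<lambda>_. 1)) G"
  let ?Q = "subst G (generic_sum n d s UNIV (\<lambda>_. 0))"
  let ?R = "\<Prod>t<s. \<Prod>i<d. Var (to_nat (t, i, 0 :: nat)) :: (nat, 'k) mpoly"
  have "?Q * ?R = 0"
  proof (rule mp_eval_eq_0_imp_0)
    fix a :: "nat \<Rightarrow> 'k"
    define b :: "idx \<Rightarrow> 'k" where "b x = a (to_nat x)" for x
    have Q: "mp_eval ?Q a = mp_eval G (lookup (sum_of_products n d s b))"
      by (simp add: mp_eval_subst mp_eval_generic_sum b_def[abs_def])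
    have R: "mp_eval ?R a = (\<Prod>t<s. \<Prod>i<d. b (t, i, 0))"
      by (simp add: mp_eval_prod b_def)
    show "mp_eval (?Q * ?R) a = 0"
    proof (cases "\<forall>t<s. \<forall>i<d. b (t, i, 0) \<noteq> 0")
      case True
      then obtain c f where cf: "f \<in> split_cone n d s (free_idx n d s) (\<lambda>_. 1)"
        "sum_of_products n d s b = pm_scale c f"
        using normalize_sum_of_products[OF assms(1,2), of b n] by blast
      have "mp_eval G (lookup (pm_scale c f)) = c ^ e * mp_eval G (lookup f)"
        using mp_eval_scale[OF G, of c "lookup f"] by (simp add: lookup_pm_scale[abs_def])
      then have "mp_eval ?Q a = 0"
        using v cf by (simp add: Q vanish_def)
      then show ?thesis by (simp add: mp_eval_mult)
    next
      case False
      then have "mp_eval ?R a = 0" unfolding R by auto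
      then show ?thesis by (simp add: mp_eval_mult)
    qed
  qed
  moreover have "?R \<noteq> 0"
    by (simp add: Var_neq_0)
  ultimately have "?Q = 0" by (metis mult_eq_0_iff)
  then have "vanish (split_cone n d s UNIV (\<lambda>_. 0)) G"
    using parametrizesD[OF parametrizes_generic_sum G] by blast
  then show "\<forall>b. mp_eval G (lookup (sum_of_products n d s b)) = 0"
    by (auto simp: vanish_def split_cone_def)
qed (auto simp: vanish_def split_cone_def)

lemma span_Union_lines:
  fixes F :: "nat \<Rightarrow> ('v \<Rightarrow>\<^sub>0 'k::field)"
  assumes "f \<in> pm.span (\<Union>t<s. pm.span {F t})"
  obtains c where "f = (\<Sum>t<s. pm_scale (c t) (F t))"
proof -
  have "pm.span (\<Union>t<s. pm.span {F t}) \<subseteq> {\<Sum>t<s. pm_scale (c t) (F t) | c. True}"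
  proof (rule pm.span_minimal)
    show "(\<Union>t<s. pm.span {F t}) \<subseteq> {\<Sum>t<s. pm_scale (c t) (F t) | c. True}"
    proof
      fix f assume "f \<in> (\<Union>t<s. pm.span {F t})"
      then obtain t c where t: "t < s" "f = pm_scale c (F t)"
        by (auto simp: pm.span_singleton)
      have "(\<Sum>u<s. pm_scale (if u = t then c else 0) (F u)) = (\<Sum>u\<in>{t}. pm_scale (if u = t then c else 0) (F u))"
        by (rule sum.mono_neutral_right) (use t in auto)
      then have "f = (\<Sum>u<s. pm_scale (if u = t then c else 0) (F u))" by (simp add: t)
      then show "f \<in> {\<Sum>t<s. pm_scale (c t) (F t) | c. True}"
        by (intro CollectI exI[of _ "\<lambda>u. if u = t then c else 0"] conjI TrueI)
    qed
    show "pm.subspace {\<Sum>t<s. pm_scale (c t) (F t) | c. True}"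
    proof (rule pm.subspaceI)
      show "0 \<in> {\<Sum>t<s. pm_scale (c t) (F t) | c. True}"
        by (auto intro!: exI[of _ "\<lambda>_. 0"])
    next
      fix x y assume "x \<in> {\<Sum>t<s. pm_scale (c t) (F t) | c. True}"
        "y \<in> {\<Sum>t<s. pm_scale (c t) (F t) | c. True}"
      then obtain c c' where "x = (\<Sum>t<s. pm_scale (c t) (F t))" "y = (\<Sum>t<s. pm_scale (c' t) (F t))"
        by auto
      then have "x + y = (\<Sum>t<s. pm_scale (c t + c' t) (F t))"
        by (simp add: pm.scale_left_distrib sum.distrib)
      then show "x + y \<in> {\<Sum>t<s. pm_scale (c t) (F t) | c. True}"
        by (intro CollectI exI[of _ "\<lambda>t. c t + c' t"] conjI TrueI)
    next
      fix a x assume "x \<in> {\<Sum>t<s. pm_scale (c t) (F t) | c. True}"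
      then obtain c where "x = (\<Sum>t<s. pm_scale (c t) (F t))" by auto
      then have "pm_scale a x = (\<Sum>t<s. pm_scale (a * c t) (F t))"
        by (simp add: pm.scale_sum_right)
      then show "pm_scale a x \<in> {\<Sum>t<s. pm_scale (c t) (F t) | c. True}"
        by (intro CollectI exI[of _ "\<lambda>t. a * c t"] conjI TrueI)
    qed
  qed
  then show ?thesis using assms that by auto
qed

lemma linear_form_eq:
  fixes l :: "(nat, 'k::comm_ring_1) mpoly"
  assumes "l \<in> forms {..n} 1"
  shows "l = (\<Sum>k\<le>n. Poly_Mapping.single (Poly_Mapping.single k 1) (lookup l (Poly_Mapping.single k 1)))"
proof -
  let ?h = "\<lambda>k. Poly_Mapping.single k (1::nat)"
  have inj: "inj ?h"
    by (rule injI) (metis lookup_single_eq lookup_single_not_eq zero_neq_one)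
  have sub: "keys l \<subseteq> ?h ` {..n}"
  proof
    fix m assume "m \<in> keys l"
    then have m: "keys m \<subseteq> {..n}" "mdeg m = 1"
      using assms by (auto simp: forms_def monoms_def)
    then obtain k where "m = ?h k" using mdeg_eq_1 by blast
    then show "m \<in> ?h ` {..n}" using m(1) by auto
  qed
  have "l = (\<Sum>m\<in>keys l. Poly_Mapping.single m (lookup l m))"
    by (rule poly_mapping_sum_single)
  also have "\<dots> = (\<Sum>m\<in>?h ` {..n}. Poly_Mapping.single m (lookup l m))"
    by (rule sum.mono_neutral_left) (use sub in \<open>auto simp: in_keys_iff\<close>)
  also have "\<dots> = (\<Sum>k\<le>n. Poly_Mapping.single (?h k) (lookup l (?h k)))"
    by (subst sum.reindex) (use inj in \<open>auto intro: inj_on_subset\<close>)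
  finally show ?thesis .
qed

lemma secant_Split_eq:
  fixes n d s :: nat
  assumes "d > 0" "s > 0"
  shows "secant (monoms {..n} d) s (Split d n :: (nat, 'k::field_char_0) mpoly set set)
    = proj_closure (monoms {..n} d) (split_cone n d s (free_idx n d s) (\<lambda>_. 1))"
proof -
  let ?V = "monoms {..n} d"
  let ?X = "Split d n :: (nat, 'k) mpoly set set"
  define U where "U = (\<Union>x \<in> {x :: nat \<Rightarrow> _. \<forall>i<s. x i \<in> ?X}. proj_span ?V (x ` {..<s}))"
  have U_sub: "U \<subseteq> proj_space ?V"
    by (auto simp: U_def proj_span_def)
  have in_U: "\<exists>b :: idx \<Rightarrow> 'k. f = sum_of_products n d s b" if f: "f \<in> \<Union>U" for f
  proof -
    obtain x where x: "\<forall>t<s. x t \<in> ?X" and fx: "f \<in> pm.span (\<Union>(x ` {..<s}))"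
      using f by (auto simp: U_def proj_span_def)
    have "\<forall>t\<in>{..<s}. \<exists>l :: nat \<Rightarrow> (nat, 'k) mpoly. x t = pm.span {\<Prod>i<d. l i} \<and> (\<forall>i<d. l i \<in> forms {..n} 1)"
    proof
      fix t assume "t \<in> {..<s}"
      then have "x t \<in> ?X" using x by simp
      then show "\<exists>l :: nat \<Rightarrow> (nat, 'k) mpoly. x t = pm.span {\<Prod>i<d. l i} \<and> (\<forall>i<d. l i \<in> forms {..n} 1)"
        unfolding Split_def by blast
    qed
    then obtain l :: "nat \<Rightarrow> nat \<Rightarrow> (nat, 'k) mpoly" where
      l: "\<And>t. t < s \<Longrightarrow> x t = pm.span {\<Prod>i<d. l t i}"
        "\<And>t i. t < s \<Longrightarrow> i < d \<Longrightarrow> l t i \<in> forms {..n} 1"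
      by (metis lessThan_iff)
    have "(\<Union>(x ` {..<s})) = (\<Union>t<s. pm.span {\<Prod>i<d. l t i})"
      using l(1) by auto
    with fx have "f \<in> pm.span (\<Union>t<s. pm.span {\<Prod>i<d. l t i})"
      by simp
    then obtain c where c: "f = (\<Sum>t<s. pm_scale (c t) (\<Prod>i<d. l t i))"
      by (rule span_Union_lines)
    \<comment> \<open>The scalar with which a product enters the linear span is absorbed by its
      factor number 0, which exists since \<open>d > 0\<close>.\<close>
    define b where "b x = (case x of (t, i, k) \<Rightarrow>
      (if i = 0 then c t else 1) * lookup (l t i) (Poly_Mapping.single k 1))" for x :: idx
    define b0 where "b0 x = (case x of (t, i, k) \<Rightarrow> lookup (l t i) (Poly_Mapping.single k 1))" for x :: idx
    have "(\<Prod>i<d. linear_factor n b t i) = pm_scale (c t) (\<Prod>i<d. l t i)" if t: "t < s" for t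
    proof -
      have "(\<Prod>i<d. linear_factor n b t i) = (\<Prod>i<d. pm_scale (if i = 0 then c t else 1) (linear_factor n b0 t i))"
        by (intro prod.cong linear_factor_scale) (auto simp: b_def b0_def)
      also have "\<dots> = pm_scale (\<Prod>i<d. if i = 0 then c t else 1) (\<Prod>i<d. linear_factor n b0 t i)"
        by (rule prod_pm_scale)
      also have "(\<Prod>i<d. linear_factor n b0 t i) = (\<Prod>i<d. l t i)"
        by (rule prod.cong)
          (use linear_form_eq[OF l(2)[OF t]] in \<open>simp_all add: linear_factor_def b0_def\<close>)
      finally show ?thesis using \<open>d > 0\<close> by simp
    qed
    then have f_eq: "f = sum_of_products n d s b"
      by (simp add: c sum_of_products_def)
    show ?thesis by (rule exI[of _ b]) (rule f_eq)
  qed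
  have to_U: "sum_of_products n d s b \<in> \<Union>U" for b :: "idx \<Rightarrow> 'k"
  proof -
    \<comment> \<open>Points of the Chow variety need nonzero factors. If a factor is zero, the
      product is zero and lies on any line, so the line of the \<open>d\<close>th power of
      \<open>Var 0\<close> stands in.\<close>
    define l where "l t i = (if \<forall>j<d. linear_factor n b t j \<noteq> 0 then linear_factor n b t i else Var 0)"
      for t i
    define x where "x t = pm.span {\<Prod>i<d. l t i}" for t
    have l: "l t i \<in> forms {..n} 1 - {0}" if "i < d" for t i
      using that linear_factor_forms[of n b t i] Var_in_forms[of 0 "{..n}", where ?'b = 'k]
      by (simp add: l_def Var_neq_0)
    then have x: "x t \<in> ?X" for t
      unfolding Split_def x_def by blast
    have "(\<Prod>i<d. linear_factor n b t i) \<in> x t" for t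
    proof (cases "\<forall>j<d. linear_factor n b t j \<noteq> 0")
      case True
      then show ?thesis by (simp add: x_def l_def pm.span_base)
    next
      case False
      then have zero: "(\<Prod>i<d. linear_factor n b t i) = 0" by auto
      show ?thesis unfolding zero x_def by (rule pm.span_zero)
    qed
    then have F: "sum_of_products n d s b \<in> pm.span (\<Union>(x ` {..<s}))"
      unfolding sum_of_products_def by (intro pm.span_sum pm.span_base) auto
    show ?thesis
    proof (cases "sum_of_products n d s b = 0")
      case True
      \<comment> \<open>The zero vector spans no point, but it lies on the line \<open>x 0\<close>,
        available because \<open>s > 0\<close>.\<close>
      have "x 0 \<in> proj_space ?V"
        using x[of 0] Split_subset_proj_space by blast
      moreover have "x 0 \<subseteq> pm.span (\<Union>(x ` {..<s}))"
        using \<open>s > 0\<close> by (intro order_trans[OF _ pm.span_superset]) auto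
      ultimately have "x 0 \<in> U"
        using x by (auto simp: U_def proj_span_def)
      moreover have "0 \<in> x 0" by (simp add: x_def pm.span_zero)
      ultimately show ?thesis using True by auto
    next
      case False
      then have "pm.span {sum_of_products n d s b} \<in> proj_space ?V"
        using sum_of_products_forms[of n d s b] by (auto simp: proj_space_def forms_def)
      moreover have "pm.span {sum_of_products n d s b} \<subseteq> pm.span (\<Union>(x ` {..<s}))"
        using F by (intro pm.span_minimal) auto
      ultimately have "pm.span {sum_of_products n d s b} \<in> U"
        using x by (auto simp: U_def proj_span_def)
      then show ?thesis using pm.span_base[of "sum_of_products n d s b"] by blast
    qed
  qed
  have "secant ?V s ?X = proj_closure ?V (\<Union>U)"
    unfolding secant_def U_def[symmetric] by (rule closure_of_eq_proj_closure[OF U_sub])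
  also have "\<dots> = proj_closure ?V (split_cone n d s (free_idx n d s) (\<lambda>_. 1))"
  proof (rule proj_closure_cong)
    fix e and G :: "(nat \<Rightarrow>\<^sub>0 nat, 'k) mpoly" assume G: "G \<in> forms ?V e"
    show "vanish (\<Union>U) G \<longleftrightarrow> vanish (split_cone n d s (free_idx n d s) (\<lambda>_. 1)) G"
      unfolding vanish_split_cone_iff[OF assms G] using in_U to_U by (force simp: vanish_def)
  qed
  finally show ?thesis .
qed

lemma split_cone_cong:
  "(\<And>x. x \<notin> J \<Longrightarrow> p x = p' x) \<Longrightarrow> split_cone n d s J p = split_cone n d s J p'"
  unfolding split_cone_def by (intro Collect_cong) (metis (no_types, lifting))

section \<open>From \<open>n0\<close> to larger \<open>n\<close>\<close>

text \<open>Extracting the terms linear in a new variable \<open>x\<^sub>k\<close> from a relation and multiplying them by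
  \<open>x\<^sub>1\<close> gives a relation among the old derivatives.\<close>

lemma indep_at_extend:
  fixes p :: "idx \<Rightarrow> 'k::field"
  assumes ind: "indep_at n0 d s (free_idx n0 d s) p" and "n0 > 0" "n0 \<le> n"
    and p: "\<And>x. x \<notin> free_idx n0 d s \<Longrightarrow> p x = 1"
  shows "\<exists>p' :: idx \<Rightarrow> 'k. (\<forall>x. x \<notin> free_idx n d s \<longrightarrow> p' x = 1) \<and> indep_at n d s (free_idx n d s) p'"
proof -
  let ?N = "{..<s} \<times> {..<d} \<times> {n0<..n}"
  let ?J0 = "free_idx n0 d s"
  have J: "free_idx n d s = ?J0 \<union> ?N" "?J0 \<inter> ?N = {}"
    using \<open>n0 \<le> n\<close> by (auto simp: free_idx_def)
  have fin: "finite ?J0" "finite ?N" by (auto simp: free_idx_def)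
  \<comment> \<open>Zero in the new positions leaves every linear factor unchanged, hence also the
    sum and its old derivatives.\<close>
  define p' where "p' x = (if x \<in> ?N then 0 else p x)" for x
  have lin: "linear_factor n p' t i = linear_factor n0 p t i" if ti: "t < s" "i < d" for t i
  proof -
    have "linear_factor n p' t i = (\<Sum>k\<le>n0. Poly_Mapping.single (Poly_Mapping.single k 1) (p' (t, i, k)))"
      unfolding linear_factor_def
      by (rule sum.mono_neutral_right) (use \<open>n0 \<le> n\<close> ti in \<open>auto simp: p'_def\<close>)
    also have "\<dots> = linear_factor n0 p t i"
      unfolding linear_factor_def by (rule sum.cong) (auto simp: p'_def)
    finally show ?thesis .
  qed
  define q where "q t i = (\<Prod>j\<in>{..<d} - {i}. linear_factor n0 p t j)" for t i
  have sop: "sum_of_products n d s p' = sum_of_products n0 d s p"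
    unfolding sum_of_products_def by (intro sum.cong prod.cong) (auto simp: lin)
  have pp: "partial_product n d p' (t, i, k) = Var k * q t i"
    "partial_product n0 d p (t, i, k) = Var k * q t i" if "t < s" for t i k
    using that by (auto simp: partial_product_def q_def lin intro!: prod.cong)
  have pp0: "partial_product n d p' x = partial_product n0 d p x" if "x \<in> ?J0" for x
    using that pp by (cases x) (auto simp: free_idx_def)
  have pd_lin: "pd k (linear_factor n0 p t i) = 0" if "k > n0" for k t i
    unfolding linear_factor_def derivation_sum[OF derivation_pd]
    by (rule sum.neutral) (use that in \<open>auto simp: pd_single lookup_single\<close>)
  have pd_q: "pd k (q t i) = 0" if "k > n0" for k t i
    unfolding q_def by (subst derivation_prod[OF derivation_pd]) (simp_all add: pd_lin[OF that])
  have pd_sop: "pd k (sum_of_products n0 d s p) = 0" if "k > n0" for k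
    unfolding sum_of_products_def derivation_sum[OF derivation_pd]
    by (subst derivation_prod[OF derivation_pd]) (simp_all add: pd_lin[OF that])
  have pd_scale: "pd k (pm_scale c f) = pm_scale c (pd k f)" for k c and f :: "(nat, 'k) mpoly"
    by (simp add: pm_scale_eq_single_mult pd_mult)
  have ind': "indep_at n d s (free_idx n d s) p'"
    unfolding indep_at_def
  proof (intro allI impI)
    fix c0 c assume "pm_scale c0 (sum_of_products n d s p')
        + (\<Sum>x\<in>free_idx n d s. pm_scale (c x) (partial_product n d p' x)) = 0"
    also have "(\<Sum>x\<in>free_idx n d s. pm_scale (c x) (partial_product n d p' x))
        = (\<Sum>x\<in>?J0. pm_scale (c x) (partial_product n0 d p x))
          + (\<Sum>x\<in>?N. pm_scale (c x) (partial_product n d p' x))"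
      unfolding J(1) by (subst sum.union_disjoint[OF fin J(2)]) (simp add: pp0)
    also have "(\<Sum>x\<in>?N. pm_scale (c x) (partial_product n d p' x))
        = (\<Sum>t<s. \<Sum>i<d. \<Sum>k\<in>{n0<..n}. pm_scale (c (t, i, k)) (Var k * q t i))"
    proof -
      have "(\<Sum>x\<in>?N. pm_scale (c x) (partial_product n d p' x))
          = (\<Sum>x\<in>?N. pm_scale (c x) (Var (snd (snd x)) * q (fst x) (fst (snd x))))"
        by (rule sum.cong) (auto simp: pp)
      then show ?thesis by (simp add: sum.cartesian_product split_def)
    qed
    finally have rel: "pm_scale c0 (sum_of_products n0 d s p)
        + ((\<Sum>x\<in>?J0. pm_scale (c x) (partial_product n0 d p x))
        + (\<Sum>t<s. \<Sum>i<d. \<Sum>k\<in>{n0<..n}. pm_scale (c (t, i, k)) (Var k * q t i))) = 0"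
      by (simp only: sop)
    have cN: "c (t, i, k) = 0" if x: "(t, i, k) \<in> ?N" for t i k
    proof -
      have k: "n0 < k" "k \<in> {n0<..n}" using x by auto
      \<comment> \<open>\<open>pd k\<close> performs the extraction: the sum and the old derivatives
        do not involve the variable \<open>k\<close>, and each new derivative involves a single new
        variable to the first power.\<close>
      have "pd k (partial_product n0 d p x) = 0" if J0: "x \<in> ?J0" for x
      proof -
        obtain t i k' where x: "x = (t, i, k')" "t < s" "k' \<le> n0"
          using J0 by (cases x) (auto simp: free_idx_def)
        then show ?thesis using k by (simp add: pp pd_mult pd_q[OF k(1)] pd_Var)
      qed
      moreover have "(\<Sum>k'\<in>{n0<..n}. pm_scale (c (t, i, k')) (pd k (Var k' * q t i)))
          = pm_scale (c (t, i, k)) (q t i)" for t i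
      proof -
        have "(\<Sum>k'\<in>{n0<..n}. pm_scale (c (t, i, k')) (pd k (Var k' * q t i)))
            = (\<Sum>k'\<in>{n0<..n}. if k = k' then pm_scale (c (t, i, k')) (q t i) else 0)"
          by (rule sum.cong) (auto simp: pd_mult pd_q[OF k(1)] pd_Var)
        then show ?thesis using k by simp
      qed
      ultimately have "(\<Sum>t<s. \<Sum>i<d. pm_scale (c (t, i, k)) (q t i)) = 0"
        using arg_cong[OF rel, of "pd k"]
        by (simp add: pd_add pd_scale derivation_sum[OF derivation_pd] pd_sop[OF k(1)])
      then have "Var 1 * (\<Sum>t<s. \<Sum>i<d. pm_scale (c (t, i, k)) (q t i)) = 0"
        by simp
      then have *: "(\<Sum>t<s. \<Sum>i<d. pm_scale (c (t, i, k)) (Var 1 * q t i)) = 0"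
        by (simp add: sum_distrib_left pm_scale_mult_right)
      \<comment> \<open>The coefficients found at the variable \<open>k\<close> are moved to the
        variable 1, whose indices are free because \<open>n0 > 0\<close>.\<close>
      define c' where "c' x = (case x of (t, i, k') \<Rightarrow> if k' = 1 then c (t, i, k) else 0)" for x :: idx
      have "(\<Sum>x\<in>?J0. pm_scale (c' x) (partial_product n0 d p x))
          = (\<Sum>x\<in>{..<s} \<times> {..<d} \<times> {1}. pm_scale (c' x) (partial_product n0 d p x))"
        by (rule sum.mono_neutral_right)
          (use fin \<open>n0 > 0\<close> in \<open>auto simp: free_idx_def c'_def split: if_splits\<close>)
      also have "\<dots> = (\<Sum>t<s. \<Sum>i<d. pm_scale (c (t, i, k)) (Var 1 * q t i))"
      proof -
        have "(\<Sum>x\<in>{..<s} \<times> {..<d} \<times> {1}. pm_scale (c' x) (partial_product n0 d p x))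
            = (\<Sum>x\<in>{..<s} \<times> {..<d} \<times> {1}. pm_scale (c (fst x, fst (snd x), k))
                (Var (snd (snd x)) * q (fst x) (fst (snd x))))"
          by (rule sum.cong) (auto simp: pp c'_def)
        also have "\<dots> = (\<Sum>t<s. \<Sum>i<d. \<Sum>k'\<in>{1}. pm_scale (c (t, i, k)) (Var k' * q t i))"
          by (simp only: sum.cartesian_product split_def fst_conv snd_conv)
        finally show ?thesis by simp
      qed
      finally have "\<forall>x\<in>?J0. c' x = 0"
        using * ind[unfolded indep_at_def, rule_format, of 0 c'] by simp
      moreover have "(t, i, 1) \<in> ?J0" using x \<open>n0 > 0\<close> by (auto simp: free_idx_def)
      ultimately show ?thesis by (force simp: c'_def)
    qed
    have "c0 = 0 \<and> (\<forall>x\<in>?J0. c x = 0)"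
      using rel ind[unfolded indep_at_def, rule_format, of c0 c] cN by simp
    then show "c0 = 0 \<and> (\<forall>x\<in>free_idx n d s. c x = 0)"
      unfolding J(1) using cN by auto
  qed
  have one: "\<forall>x. x \<notin> free_idx n d s \<longrightarrow> p' x = 1"
    using p unfolding J(1) by (auto simp: p'_def)
  show ?thesis by (rule exI[of _ p'], rule conjI[OF one ind'])
qed

text \<open>From \<open>n\<close> to \<open>n + 1\<close> the binomial coefficient grows by the
  factor \<open>(n + d + 1) / (n + 1)\<close>, which is at least the growth of
  \<open>d * n + 1\<close>: after clearing denominators the comparison is
  \<open>d * n \<le> d * (d * n)\<close>.\<close>

lemma binomial_bound_step:
  assumes "d > 0" "s * (d * n + 1) \<le> (n + d) choose d"
  shows "s * (d * Suc n + 1) \<le> (Suc n + d) choose d"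
proof -
  have "Suc n * ((Suc n + d) choose d) = Suc n * (Suc (n + d) choose Suc n)"
    using binomial_symmetric[of "Suc n" "Suc n + d"] by simp
  also have "\<dots> = Suc (n + d) * ((n + d) choose n)"
    by (rule Suc_times_binomial)
  also have "(n + d) choose n = (n + d) choose d"
    using binomial_symmetric[of n "n + d"] by simp
  finally have eq: "Suc n * ((Suc n + d) choose d) = Suc (n + d) * ((n + d) choose d)" .
  have "n \<le> d * n" using assms(1) by simp
  then have "d * n \<le> d * (d * n)" by (rule mult_le_mono2)
  then have "Suc n * (d * Suc n + 1) \<le> Suc (n + d) * (d * n + 1)"
    by (simp add: algebra_simps)
  then have "s * (Suc n * (d * Suc n + 1)) \<le> s * (Suc (n + d) * (d * n + 1))"
    by (rule mult_le_mono2)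
  also have "\<dots> = Suc (n + d) * (s * (d * n + 1))" by (simp only: mult_ac)
  also have "\<dots> \<le> Suc (n + d) * ((n + d) choose d)" by (rule mult_le_mono2[OF assms(2)])
  finally have "Suc n * (s * (d * Suc n + 1)) \<le> Suc n * ((Suc n + d) choose d)"
    unfolding eq by (simp only: mult_ac)
  then show ?thesis by (simp only: Suc_mult_le_cancel1)
qed

theorem theorem1p3:
  fixes d s n0 n :: nat
  assumes "d > 0" and "s > 0" and "n0 > 0"
    and "s * (d * n0 + 1) \<le> (n0 + d) choose d"
    and "nondefective TYPE('k::{alg_closed_field, field_char_0}) s d n0"
    and "n \<ge> n0"
  shows "nondefective TYPE('k) s d n"
proof -
  let ?X = "\<lambda>n. subtopology (zariski (monoms {..n} d)) (proj_closure (monoms {..n} d)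
    (split_cone n d s (free_idx n d s) (\<lambda>_. 1 :: 'k)))"
  have nondef: "nondefective TYPE('k) s d n \<longleftrightarrow> krull_dim (?X n) = enat (expdim s d n)" for n
    by (simp add: nondefective_def secant_Split_eq[OF assms(1,2)])
  have bound: "s * (d * n + 1) \<le> (n + d) choose d" if "n \<ge> n0" for n
    using that by (induction n rule: dec_induct) (use assms binomial_bound_step in auto)
  \<comment> \<open>Because the inequality persists, the minimum in \<open>expdim\<close> is always
    its first entry, and subtracting 1 gives the number of parameters.\<close>
  have expdim: "expdim s d n = card (free_idx n d s)" if "n \<ge> n0" for n
    using bound[OF that] by (simp add: expdim_def card_free_idx[OF assms(2)] min_absorb1)
  \<comment> \<open>A positive dimension is required to obtain an actual chain from the
    supremum.\<close>
  have "card (free_idx n0 d s) > 0"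
  proof -
    have "2 \<le> d * n0 + 1" using assms(1,3) by (simp add: Suc_le_eq)
    then have "1 * 2 \<le> s * (d * n0 + 1)" using assms(2) by (intro mult_le_mono) auto
    then show ?thesis using card_free_idx[OF assms(2), of n0 d] by linarith
  qed
  then obtain m Z where Z: "card (free_idx n0 d s) \<le> m" "irreducible_chain (?X n0) m Z"
    using krull_dim_chain assms(5) unfolding nondef expdim[OF order_refl] by blast
  have "free_idx n0 d s \<noteq> {}"
    using \<open>card (free_idx n0 d s) > 0\<close> by auto
  then obtain b :: "idx \<Rightarrow> 'k" where "\<forall>x. x \<notin> free_idx n0 d s \<longrightarrow> b x = 1"
    "indep_at n0 d s (free_idx n0 d s) b"
    using indep_at_of_chain[OF free_idx_subset[OF assms(1)] _ Z(2,1)] by blast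
  then obtain p :: "idx \<Rightarrow> 'k" where p: "\<forall>x. x \<notin> free_idx n d s \<longrightarrow> p x = 1"
    "indep_at n d s (free_idx n d s) p"
    using indep_at_extend[of n0 d s b n] assms(3,6) by blast
  \<comment> \<open>The point \<open>p\<close> differs from the constant 1 only at free indices, so
    the chain built around \<open>p\<close> lives in the secant variety itself.\<close>
  have "split_cone n d s (free_idx n d s) p = split_cone n d s (free_idx n d s) (\<lambda>_. 1)"
    by (rule split_cone_cong) (use p in auto)
  then have "enat (card (free_idx n d s)) \<le> krull_dim (?X n)"
    using irreducible_chain_of_indep_at[OF p(2) free_idx_subset[OF assms(1)]] krull_dim_ge by metis
  moreover have "krull_dim (?X n) \<le> enat (card (free_idx n d s))"
    by (rule krull_dim_le, rule chain_length_le) (auto simp: free_idx_def)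
  ultimately show ?thesis
    unfolding nondef expdim[OF assms(6)] by (rule antisym[rotated])
qed

end
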